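(* Let $(G,\chi_E)$ be an edge-signed connected planar graph with edge set $E=\{1,\dots,n\}$, and let $L_G$ be the link arising from $(G,\chi_E)$. Then $$\det(L_G)=\big|FH_G(\mathbf v)\big|,$$ where $\mathbf v=(v_1,\dots,v_n)$ with $v_i=\frac{1-\chi_E(i)}{2}$ (that is, $v_i=0$ if $\chi_E(i)=+$ and $v_i=1$ if $\chi_E(i)=-$).
   Context: Graphs are finite and may have loops and multiple edges. An edge-signed planar graph $(G,\chi_E)$ is a planar graph $G=(V,E)$ (drawn in the plane) with a map $\chi_E:E\to\{+,-\}$, the signs being identified with $\pm1$. Link arising from $(G,\chi_E)$: the medial graph $med(G)$ has one vertex on each edge of $G$, two vertices being joined whenever the corresponding edges are consecutive on a face of $G$ (with multiplicity); it is a 4-regular plane graph. Its faces are properly 2-colored so that the black faces are those containing the vertices of $G$ (and the white faces correspond to the faces of $G$). Turn $med(G)$ into a link diagram $D(G,\chi_E)$ by deciding the over/under strand at each vertex (crossing): at the crossing on an edge $e$ with $\chi_E(e)=+$, an observer standing in a black face at the crossing and looking towards the crossing sees the strand on their left pass over the strand on their right ("left-over-right" rule); if $\chi_E(e)=-$, the strand on the right passes over the one on the left. The link arising from $(G,\chi_E)$ is the link represented by $D(G,\chi_E)$. Determinant: $\det(L)=|V_L(-1)|=|\Delta_L(-1)|$, where $V_L$ is the Jones polynomial and $\Delta_L$ the Alexander polynomial of $L$. Fourier-Hadamard transform: for a Boolean function $f:\mathbb F_2^n\to\mathbb F_2$ with support $\mathsf{supp}(f)=\{\mathbf x: f(\mathbf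 x)\neq0\}$, $\widehat f(\mathbf u)=\sum_{\mathbf x\in\mathsf{supp}(f)}(-1)^{\mathbf x\cdot\mathbf u}\in\mathbb Z$, where $\mathbf x\cdot\mathbf u=x_1u_1\oplus\cdots\oplus x_nu_n$ is the usual inner product mod 2. Any real-valued function on $\mathbb F_2^n$ is represented (reading coordinates as the real numbers $0,1$) by an element of $\mathbb R[x_1,\dots,x_n]/(x_1^2-x_1,\dots,x_n^2-x_n)$, its Numerical Normal Form (NNF), written $\sum_{\mathbf y\in\mathbb F_2^n}\lambda_{\mathbf y}\prod_i x_i^{y_i}$. $FH_G$-polynomial: let $\mathcal T_G$ be the set of spanning trees of $G$, each identified with its edge set; for $T\in\mathcal T_G$ let $\mathbf v_T\in\mathbb F_2^n$ be its characteristic vector ($i$-th entry $1$ iff $i\in T$). Let $f_G$ be the Boolean function with $\mathsf{supp}(f_G)=\{\mathbf v_T: T\in\mathcal T_G\}$. Then $FH_G(x_1,\dots,x_n)$ is the NNF of $\widehat f_G$, i.e. $FH_G(x_1,\dots,x_n)=\widehat f_G(x_1,\dots,x_n)$. *)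

theory Defs
  imports
    Complex_Main
    "HOL-Library.Z2"
    "HOL-Library.Poly_Mapping"
    "HOL-Combinatorics.Orbits"
    "Graph_Theory.Digraph_Component"
begin

section \<open>Plane multigraphs\<close>

text \<open>
  A finite undirected graph, loops and multiple edges allowed, is given by a finite
  \<^typ>\<open>('v, 'e) pre_digraph\<close>: its arcs are the edges, and \<^const>\<open>tail\<close>/\<^const>\<open>head\<close> name the
  two ends of an edge in an arbitrary order.  Each edge \<open>e\<close> has two darts \<open>(e, False)\<close> and
  \<open>(e, True)\<close>, starting at its tail and at its head respectively.  The digraph whose arcs are
  the darts is the following one.
\<close>

definition bidirect :: "('v, 'e) pre_digraph \<Rightarrow> ('v, 'e \<times> bool) pre_digraph" where
  "bidirect G = \<lparr> verts = verts G, arcs = arcs G \<times> UNIV,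
     tail = (\<lambda>(e, b). if b then head G e else tail G e),
     head = (\<lambda>(e, b). if b then tail G e else head G e) \<rparr>"

definition dart_rev :: "'e \<times> bool \<Rightarrow> 'e \<times> bool" where
  "dart_rev d = (fst d, \<not> snd d)"

text \<open>
  The predicate \<^const>\<open>forest\<close> of the library only excludes directed cycles, so it is not the
  right notion for undirected graphs.  An undirected cycle is a cycle of darts that
  uses no edge twice; loops and pairs of parallel edges are cycles.
\<close>

definition undirected_cycle :: "('v, 'e) pre_digraph \<Rightarrow> ('e \<times> bool) list \<Rightarrow> bool" where
  "undirected_cycle G p \<longleftrightarrow> pre_digraph.cycle (bidirect G) p \<and> distinct (map fst p)"

definition spanning_trees :: "('v, 'e) pre_digraph \<Rightarrow> 'e set set" where
  "spanning_trees G = {T. T \<subseteq> arcs G \<and> Digraph_Component.connected (G\<lparr>arcs := T\<rparr>) \<and>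
     (\<nexists>p. undirected_cycle (G\<lparr>arcs := T\<rparr>) p)}"

text \<open>
  A drawing of a connected graph in the oriented plane (or sphere) is recorded by its rotation
  system: \<open>\<sigma>\<close> maps every dart to the next dart in counterclockwise order around the vertex at
  which it starts.  The faces are the cycles of \<open>\<sigma> \<circ> dart_rev\<close> (a dart is mapped
  to the next dart along the boundary of the face on its right), and the drawing is in the plane
  iff Euler's formula holds.  The graph with one vertex and no edge has no darts but one face.
\<close>

definition rotation_system :: "('v, 'e) pre_digraph \<Rightarrow> ('e \<times> bool \<Rightarrow> 'e \<times> bool) \<Rightarrow> bool" where
  "rotation_system G \<sigma> \<longleftrightarrow> \<sigma> permutes arcs (bidirect G) \<and>
     (\<forall>v \<in> verts G. out_arcs (bidirect G) v \<noteq> {} \<longrightarrow> cyclic_on \<sigma> (out_arcs (bidirect G) v))"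

definition face_cycles :: "('v, 'e) pre_digraph \<Rightarrow> ('e \<times> bool \<Rightarrow> 'e \<times> bool) \<Rightarrow> ('e \<times> bool) set set" where
  "face_cycles G \<sigma> = orbit (\<sigma> \<circ> dart_rev) ` arcs (bidirect G)"

definition num_faces :: "('v, 'e) pre_digraph \<Rightarrow> ('e \<times> bool \<Rightarrow> 'e \<times> bool) \<Rightarrow> nat" where
  "num_faces G \<sigma> = (if arcs G = {} then 1 else card (face_cycles G \<sigma>))"

definition connected_plane_graph :: "('v, 'e) pre_digraph \<Rightarrow> ('e \<times> bool \<Rightarrow> 'e \<times> bool) \<Rightarrow> bool" where
  "connected_plane_graph G \<sigma> \<longleftrightarrow> fin_digraph G \<and> Digraph_Component.connected G \<and>
     rotation_system G \<sigma> \<and>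
     card (verts G) + num_faces G \<sigma> = card (arcs G) + 2"

section \<open>Link diagrams and the Jones polynomial\<close>

text \<open>
  The four ends of the two strands at a crossing, listed counterclockwise.  The compass names
  only fix a cyclic order at each crossing; one strand joins \<open>NE\<close> to \<open>SW\<close>, the other one
  \<open>NW\<close> to \<open>SE\<close>, and the four regions at the crossing are called north (between \<open>NE\<close> and \<open>NW\<close>),
  west, south and east.
\<close>

datatype compass = NE | NW | SW | SE

fun ccw :: "compass \<Rightarrow> compass" where
  "ccw NE = NW" | "ccw NW = SW" | "ccw SW = SE" | "ccw SE = NE"

definition opposite :: "compass \<Rightarrow> compass" where
  "opposite x = ccw (ccw x)"

text \<open>
  A link diagram is a 4-regular plane graph with over/under information: \<open>glue\<close> tells which
  ends of crossings are the two ends of one and the same edge,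
  \<open>nwse_over c\<close> tells whether the strand from \<open>NW\<close> to \<open>SE\<close> is the upper one at \<open>c\<close>, and
  \<open>circles\<close> counts the additional closed components without crossings.
\<close>

record 'c link_diagram =
  crossings :: "'c set"
  glue :: "'c \<times> compass \<Rightarrow> 'c \<times> compass"
  nwse_over :: "'c \<Rightarrow> bool"
  circles :: nat

definition strand_ends :: "'c link_diagram \<Rightarrow> ('c \<times> compass) set" where
  "strand_ends D = crossings D \<times> UNIV"

definition wf_diagram :: "'c link_diagram \<Rightarrow> bool" where
  "wf_diagram D \<longleftrightarrow> finite (crossings D) \<and>
     (\<forall>h \<in> strand_ends D. glue D h \<in> strand_ends D \<and> glue D h \<noteq> h \<and> glue D (glue D h) = h)"

text \<open>
  An orientation of all components without the crossing-free circles (whose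
  orientation never matters): \<open>out h\<close> holds iff the strand is directed away from the crossing
  at the end \<open>h\<close>.
\<close>

definition orientation :: "'c link_diagram \<Rightarrow> ('c \<times> compass \<Rightarrow> bool) \<Rightarrow> bool" where
  "orientation D out \<longleftrightarrow>
     (\<forall>c \<in> crossings D. \<forall>x. out (c, opposite x) \<longleftrightarrow> \<not> out (c, x)) \<and>
     (\<forall>h \<in> strand_ends D. out (glue D h) \<longleftrightarrow> \<not> out h)"

definition upper_ends :: "'c link_diagram \<Rightarrow> 'c \<Rightarrow> compass set" where
  "upper_ends D c = (if nwse_over D c then {NW, SE} else {NE, SW})"

text \<open>A crossing is positive iff turning the direction of the upper strand counterclockwise by a
  right angle gives the direction of the lower strand.\<close>

definition crossing_sign :: "'c link_diagram \<Rightarrow> ('c \<times> compass \<Rightarrow> bool) \<Rightarrow> 'c \<Rightarrow> int" where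
  "crossing_sign D out c =
     (if \<exists>x \<in> upper_ends D c. out (c, x) \<and> out (c, ccw x) then 1 else - 1)"

definition writhe :: "'c link_diagram \<Rightarrow> ('c \<times> compass \<Rightarrow> bool) \<Rightarrow> int" where
  "writhe D out = (\<Sum>c \<in> crossings D. crossing_sign D out c)"

text \<open>
  The two ways of smoothing a crossing: \<open>join_WE\<close> merges the west and the east region,
  \<open>join_NS\<close> the north and the south region.  The A-regions are the two regions swept out
  when the upper strand is turned counterclockwise: west and east if the upper strand joins
  \<open>NW\<close> to \<open>SE\<close>, north and south otherwise.  The A-smoothing merges the A-regions, the
  B-smoothing the other two.  A state is given by the set \<open>S\<close> of A-smoothed crossings.
\<close>

fun join_WE :: "compass \<Rightarrow> compass" where
  "join_WE NE = NW" | "join_WE NW = NE" | "join_WE SW = SE" | "join_WE SE = SW"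

fun join_NS :: "compass \<Rightarrow> compass" where
  "join_NS NE = SE" | "join_NS SE = NE" | "join_NS NW = SW" | "join_NS SW = NW"

definition smooth :: "'c link_diagram \<Rightarrow> 'c set \<Rightarrow> 'c \<times> compass \<Rightarrow> 'c \<times> compass" where
  "smooth D S = (\<lambda>(c, x). (c, if (c \<in> S \<longleftrightarrow> nwse_over D c) then join_WE x else join_NS x))"

definition num_loops :: "'c link_diagram \<Rightarrow> 'c set \<Rightarrow> nat" where
  "num_loops D S = circles D +
     card (strand_ends D // {(h, k). h \<in> strand_ends D \<and> (k = glue D h \<or> k = smooth D S h)}\<^sup>*)"

text \<open>
  Integer Laurent polynomials are the elements of the group ring \<^typ>\<open>int \<Rightarrow>\<^sub>0 int\<close>;
  \<^term>\<open>Poly_Mapping.single k a\<close> is the monomial with coefficient \<open>a\<close> and exponent \<open>k\<close>.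
  The Kauffman bracket is a polynomial in the variable \<open>A\<close>, normalised to be \<open>1\<close> on a circle
  without crossings.
\<close>

type_synonym laurent = "int \<Rightarrow>\<^sub>0 int"

definition laurent_eval :: "laurent \<Rightarrow> complex \<Rightarrow> complex" where
  "laurent_eval p z = (\<Sum>k \<in> Poly_Mapping.keys p. of_int (Poly_Mapping.lookup p k) * z powi k)"

definition kauffman_bracket :: "'c link_diagram \<Rightarrow> laurent" where
  "kauffman_bracket D = (\<Sum>S \<in> Pow (crossings D).
     Poly_Mapping.single (int (card S) - int (card (crossings D - S))) 1 *
     (- Poly_Mapping.single 2 1 - Poly_Mapping.single (- 2) 1) ^ (num_loops D S - 1))"

text \<open>
  The Jones polynomial is \<open>V(t) = (- A\<^sup>3)\<^bsup>-w\<^esup> \<langle>D\<rangle>\<close> with \<open>A = t\<^bsup>-1/4\<^esup>\<close> and \<open>w\<close> the writhe.  Only even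
  powers of \<open>A\<close> occur, and it is recorded as a Laurent polynomial in \<open>t\<^bsup>1/2\<^esup> = A\<^bsup>-2\<^esup>\<close>.
\<close>

definition jones_polynomial :: "'c link_diagram \<Rightarrow> ('c \<times> compass \<Rightarrow> bool) \<Rightarrow> laurent" where
  "jones_polynomial D out = Poly_Mapping.map_key (\<lambda>k. - 2 * k)
     (Poly_Mapping.single (- 3 * writhe D out) ((- 1) ^ nat \<bar>writhe D out\<bar>) * kauffman_bracket D)"

text \<open>The value at \<open>t = - 1\<close> is taken at \<open>t\<^bsup>1/2\<^esup> = \<i>\<close>; the other root only changes its sign
  or nothing at all, since the exponents of \<open>t\<^bsup>1/2\<^esup>\<close> all have the same parity.\<close>

definition link_det :: "'c link_diagram \<Rightarrow> ('c \<times> compass \<Rightarrow> bool) \<Rightarrow> real" where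
  "link_det D out = cmod (laurent_eval (jones_polynomial D out) \<i>)"

section \<open>The link diagram of an edge-signed plane graph\<close>

text \<open>
  The crossing on the edge \<open>e\<close> is viewed with the dart \<open>(e, False)\<close> pointing east and
  \<open>(e, True)\<close> pointing west.  So the west and east regions are the black ones
  (containing the tail and the head of \<open>e\<close>), and north and south are white.  For a dart \<open>d\<close>,
  \<open>after_end d\<close> is the end of the medial graph in the corner between \<open>d\<close> and
  \<open>\<sigma> d\<close>, and \<open>before_end d\<close> the one in the corner between \<open>\<sigma>\<^sup>-\<^sup>1 d\<close> and \<open>d\<close>.  The corners
  are the places where two edges are consecutive on a face; each gives one edge of the medial
  graph.
\<close>

definition after_end :: "'e \<times> bool \<Rightarrow> 'e \<times> compass" where
  "after_end d = (fst d, if snd d then SE else NW)"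

definition before_end :: "'e \<times> bool \<Rightarrow> 'e \<times> compass" where
  "before_end d = (fst d, if snd d then NE else SW)"

fun medial_glue :: "('e \<times> bool \<Rightarrow> 'e \<times> bool) \<Rightarrow> 'e \<times> compass \<Rightarrow> 'e \<times> compass" where
  "medial_glue \<sigma> (e, NW) = before_end (\<sigma> (e, False))"
| "medial_glue \<sigma> (e, SE) = before_end (\<sigma> (e, True))"
| "medial_glue \<sigma> (e, SW) = after_end (inv \<sigma> (e, False))"
| "medial_glue \<sigma> (e, NE) = after_end (inv \<sigma> (e, True))"

text \<open>
  For an observer in the west region looking east, the strand from \<open>NW\<close> to \<open>SE\<close> is the left one;
  it is also the left one for an observer in the east region looking west.  Hence it is the upper
  one at the edges with sign \<open>+\<close>.  The medial graph of a single vertex without edges is a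
  circle.
\<close>

definition medial_diagram ::
  "('v, 'e) pre_digraph \<Rightarrow> ('e \<times> bool \<Rightarrow> 'e \<times> bool) \<Rightarrow> ('e \<Rightarrow> int) \<Rightarrow> 'e link_diagram" where
  "medial_diagram G \<sigma> \<chi> = \<lparr> crossings = arcs G, glue = medial_glue \<sigma>,
     nwse_over = (\<lambda>e. \<chi> e = 1),
     circles = card {v \<in> verts G. out_arcs (bidirect G) v = {}} \<rparr>"

section \<open>The Fourier-Hadamard transform and the numerical normal form\<close>

text \<open>Vectors over the field with two elements are indexed by \<open>{1..n}\<close>, extended by zero.\<close>

definition cube :: "nat \<Rightarrow> (nat \<Rightarrow> bit) set" where
  "cube n = {x. \<forall>i. i \<notin> {1..n} \<longrightarrow> x i = 0}"

definition dot :: "nat \<Rightarrow> (nat \<Rightarrow> bit) \<Rightarrow> (nat \<Rightarrow> bit) \<Rightarrow> bit" where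
  "dot n x u = (\<Sum>i\<in>{1..n}. x i * u i)"

definition bool_supp :: "nat \<Rightarrow> ((nat \<Rightarrow> bit) \<Rightarrow> bit) \<Rightarrow> (nat \<Rightarrow> bit) set" where
  "bool_supp n f = {x \<in> cube n. f x \<noteq> 0}"

definition fourier_hadamard :: "nat \<Rightarrow> ((nat \<Rightarrow> bit) \<Rightarrow> bit) \<Rightarrow> (nat \<Rightarrow> bit) \<Rightarrow> int" where
  "fourier_hadamard n f u = (\<Sum>x \<in> bool_supp n f. (- 1) ^ of_bool (dot n x u = 1))"

text \<open>
  A multilinear real polynomial in \<open>x\<^sub>1, \<dots>, x\<^sub>n\<close> is given by its coefficient
  \<open>l y\<close> at \<open>\<Prod>i. x\<^sub>i ^ y\<^sub>i\<close> for each \<open>y\<close> in the cube.  Every real function on the cube is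
  represented by exactly one such polynomial.
\<close>

definition multilinear_eval :: "nat \<Rightarrow> ((nat \<Rightarrow> bit) \<Rightarrow> real) \<Rightarrow> (nat \<Rightarrow> real) \<Rightarrow> real" where
  "multilinear_eval n l z = (\<Sum>y \<in> cube n. l y * (\<Prod>i\<in>{1..n}. z i ^ of_bool (y i = 1)))"

definition nnf :: "nat \<Rightarrow> ((nat \<Rightarrow> bit) \<Rightarrow> real) \<Rightarrow> (nat \<Rightarrow> bit) \<Rightarrow> real" where
  "nnf n F = (THE l. (\<forall>y. y \<notin> cube n \<longrightarrow> l y = 0) \<and>
     (\<forall>x \<in> cube n. multilinear_eval n l (\<lambda>i. of_bool (x i = 1)) = F x))"

definition char_vec :: "nat set \<Rightarrow> nat \<Rightarrow> bit" where
  "char_vec T i = (if i \<in> T then 1 else 0)"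

definition tree_fun :: "('v, nat) pre_digraph \<Rightarrow> (nat \<Rightarrow> bit) \<Rightarrow> bit" where
  "tree_fun G x = (if x \<in> char_vec ` spanning_trees G then 1 else 0)"

definition FH_poly :: "nat \<Rightarrow> ('v, nat) pre_digraph \<Rightarrow> (nat \<Rightarrow> bit) \<Rightarrow> real" where
  "FH_poly n G = nnf n (\<lambda>u. of_int (fourier_hadamard n (tree_fun G) u))"

section \<open>Sanity checks\<close>

lemma wf_medial_diagram:
  fixes G :: "('v, 'e) pre_digraph"
  assumes "connected_plane_graph G \<sigma>"
  shows "wf_diagram (medial_diagram G \<sigma> \<chi>)"
proof -
  have fin: "finite (arcs G)"
    using assms by (simp add: connected_plane_graph_def fin_digraph.finite_arcs)
  have perm: "\<sigma> permutes (arcs G \<times> UNIV)"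
    using assms by (simp add: connected_plane_graph_def rotation_system_def bidirect_def)
  have inv1: "inv \<sigma> (\<sigma> d) = d" and inv2: "\<sigma> (inv \<sigma> d) = d" for d
    using permutes_inverses[OF perm] by auto
  have A: "medial_glue \<sigma> (after_end d) = before_end (\<sigma> d)" for d
    by (cases d) (auto simp: after_end_def)
  have B: "medial_glue \<sigma> (before_end d) = after_end (inv \<sigma> d)" for d
    by (cases d) (auto simp: before_end_def)
  have mem: "fst (\<sigma> d) \<in> arcs G" "fst (inv \<sigma> d) \<in> arcs G" if "fst d \<in> arcs G" for d
    using that permutes_in_image[OF perm, of d]
      permutes_in_image[OF permutes_inv[OF perm], of d]
    by (auto simp: mem_Times_iff)
  have split: "\<exists>d. fst d = fst h \<and> (h = after_end d \<or> h = before_end d)" for h :: "'e \<times> compass"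
  proof (cases h)
    case (Pair e x)
    show ?thesis
      by (cases x) (auto simp: Pair after_end_def before_end_def)
  qed
  have ne: "after_end d \<noteq> before_end d'" for d d' :: "'e \<times> bool"
    by (auto simp: after_end_def before_end_def split: if_splits)
  have "medial_glue \<sigma> h \<in> arcs G \<times> UNIV \<and> medial_glue \<sigma> h \<noteq> h \<and>
      medial_glue \<sigma> (medial_glue \<sigma> h) = h"
    if "h \<in> arcs G \<times> UNIV" for h
  proof -
    obtain d where d: "fst d = fst h" "h = after_end d \<or> h = before_end d"
      using split by blast
    have "fst d \<in> arcs G"
      using that d(1) by (simp add: mem_Times_iff)
    note m = mem[OF this]
    show ?thesis
      using d(2)
    proof
      assume h: "h = after_end d"
      show ?thesis
        unfolding h A B inv1 using m ne[of d] by (metis before_end_def UNIV_I mem_Times_iff fst_conv)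
    next
      assume h: "h = before_end d"
      show ?thesis
        unfolding h A B inv2 using m ne[of _ d] by (metis after_end_def UNIV_I mem_Times_iff fst_conv)
    qed
  qed
  then show ?thesis
    by (simp add: wf_diagram_def strand_ends_def medial_diagram_def fin)
qed

lemma alternating_colouring:
  assumes "finite H"
    and "\<forall>h\<in>H. a h \<in> H \<and> a h \<noteq> h \<and> a (a h) = h"
    and "\<forall>h\<in>H. b h \<in> H \<and> b h \<noteq> h \<and> b (b h) = h"
  shows "\<exists>f :: 'h \<Rightarrow> bool. \<forall>h\<in>H. f (a h) = (\<not> f h) \<and> f (b h) = (\<not> f h)"
  using assms
proof (induction "card H" arbitrary: H b rule: less_induct)
  case less
  show ?case
  proof (cases "H = {}")
    case False
    then obtain x where x: "x \<in> H" by blast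
    define y where "y = a x"
    have y: "y \<in> H" "y \<noteq> x" "a y = x" "a x = y"
      using less.prems(2) x by (auto simp: y_def)
    define H' where "H' = H - {x, y}"
    have card: "card H' < card H"
      unfolding H'_def using x less.prems(1) by (intro psubset_card_mono) auto
    have a': "\<forall>h\<in>H'. a h \<in> H' \<and> a h \<noteq> h \<and> a (a h) = h"
      using less.prems(2) y unfolding H'_def by (metis Diff_iff insert_iff empty_iff)
    define b' where "b' = (\<lambda>h. if b h = x then b y else if b h = y then b x else b h)"
    have b: "b h \<in> H" "b h \<noteq> h" "b (b h) = h" if "h \<in> H" for h
      using less.prems(3) that by auto
    have b': "\<forall>h\<in>H'. b' h \<in> H' \<and> b' h \<noteq> h \<and> b' (b' h) = h"
    proof
      fix h assume h: "h \<in> H'"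
      then have hH: "h \<in> H" "h \<noteq> x" "h \<noteq> y" by (auto simp: H'_def)
      show "b' h \<in> H' \<and> b' h \<noteq> h \<and> b' (b' h) = h"
        using b[OF x] b[OF y(1)] b[OF hH(1)] hH x y(1,2)
        unfolding b'_def H'_def by (smt (verit) Diff_iff insert_iff empty_iff)
    qed
    have finH': "finite H'" using less.prems(1) by (simp add: H'_def)
    obtain f :: "'h \<Rightarrow> bool" where f: "\<forall>h\<in>H'. f (a h) = (\<not> f h) \<and> f (b' h) = (\<not> f h)"
      using less.hyps[OF card finH' a' b'] by (elim exE) simp
    show ?thesis
    proof (cases "b x = y")
      case True
      then have byx: "b y = x" using b[OF x] by simp
      define g where "g = f(x := True, y := False)"
      have "g (a h) = (\<not> g h) \<and> g (b h) = (\<not> g h)" if "h \<in> H" for h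
      proof (cases "h = x \<or> h = y")
        case True
        then show ?thesis using y \<open>b x = y\<close> byx by (auto simp: g_def)
      next
        case False
        then have h: "h \<in> H'" using that by (simp add: H'_def)
        have "b h \<noteq> x" "b h \<noteq> y" using b[OF that] False True byx by auto
        moreover from this have "b' h = b h" by (simp add: b'_def)
        moreover have "a h \<noteq> x" "a h \<noteq> y" using a' h by (auto simp: H'_def)
        ultimately show ?thesis using bspec[OF f h] False by (simp add: g_def)
      qed
      then show ?thesis by (intro exI[of _ g]) simp
    next
      case False
      have bx: "b x \<in> H'" "b y \<in> H'"
        using b[OF x] b[OF y(1)] False by (auto simp: H'_def)
      have "b' (b x) = b y" using b[OF x] by (simp add: b'_def)
      then have fxy: "f (b y) = (\<not> f (b x))" using bspec[OF f bx(1)] by simp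
      define g where "g = f(x := \<not> f (b x), y := \<not> f (b y))"
      have "g (a h) = (\<not> g h) \<and> g (b h) = (\<not> g h)" if "h \<in> H" for h
      proof (cases "h = x \<or> h = y")
        case True
        then show ?thesis using y bx fxy by (auto simp: g_def H'_def)
      next
        case F: False
        then have h: "h \<in> H'" using that by (simp add: H'_def)
        have ah: "a h \<noteq> x" "a h \<noteq> y" using a' h by (auto simp: H'_def)
        consider "b h = x" | "b h = y" | "b h \<noteq> x" "b h \<noteq> y" by blast
        then show ?thesis
        proof cases
          case 1
          then have "h = b x" using b[OF that] by simp
          then show ?thesis using bspec[OF f h] ah F 1 y by (auto simp: g_def)
        next
          case 2
          then have "h = b y" using b[OF that] by simp
          then show ?thesis using bspec[OF f h] ah F 2 y by (auto simp: g_def)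
        next
          case 3
          then have "b' h = b h" by (simp add: b'_def)
          then show ?thesis using bspec[OF f h] ah F 3 by (auto simp: g_def)
        qed
      qed
      then show ?thesis by (intro exI[of _ g]) simp
    qed
  qed auto
qed

lemma orientation_exists:
  assumes "wf_diagram D"
  shows "\<exists>out. orientation D out"
proof -
  define opp where "opp = (\<lambda>(c :: 'a, x). (c, opposite x))"
  have opp: "opposite x \<noteq> x" "opposite (opposite x) = x" for x
    by (cases x; simp add: opposite_def)+
  have "finite (UNIV :: compass set)"
    by (rule finite_subset[of _ "{NE, NW, SW, SE}"]) (use compass.exhaust in auto)
  then have "finite (strand_ends D)"
    using assms by (simp add: wf_diagram_def strand_ends_def)
  moreover have "\<forall>h\<in>strand_ends D. opp h \<in> strand_ends D \<and> opp h \<noteq> h \<and> opp (opp h) = h"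
    by (auto simp: opp_def strand_ends_def opp)
  moreover have "\<forall>h\<in>strand_ends D.
      glue D h \<in> strand_ends D \<and> glue D h \<noteq> h \<and> glue D (glue D h) = h"
    using assms by (simp add: wf_diagram_def)
  ultimately have "\<exists>f :: 'a \<times> compass \<Rightarrow> bool. \<forall>h\<in>strand_ends D.
      f (opp h) = (\<not> f h) \<and> f (glue D h) = (\<not> f h)"
    by (rule alternating_colouring)
  then obtain f :: "'a \<times> compass \<Rightarrow> bool" where
    f: "\<forall>h\<in>strand_ends D. f (opp h) = (\<not> f h) \<and> f (glue D h) = (\<not> f h)"
    by (elim exE)
  have "f (c, opposite x) \<longleftrightarrow> \<not> f (c, x)" if "c \<in> crossings D" for c x
    using bspec[OF f, of "(c, x)"] that by (simp add: opp_def strand_ends_def)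
  then have "orientation D f"
    using f by (simp add: orientation_def)
  then show ?thesis by (rule exI[of _ f])
qed

end

theory Submission
  imports Defs
begin

text \<open>
  At \<open>t\<^bsup>1/2\<^esup> = \<i>\<close>, that is \<open>A\<^bsup>-2\<^esup> = \<i>\<close>, the loop value \<open>- A\<^sup>2 - A\<^bsup>-2\<^esup>\<close> vanishes, so only the states
  with a single loop contribute to the Kauffman bracket.  Describe a state by the set \<open>T\<close> of
  edges at which it merges the two black regions.  Its loops are the boundary curves of the
  ribbon surface with a disc at each vertex and a band along each edge in \<open>T\<close>.  There are at
  least as many loops as components of \<open>(V, T)\<close>, a band changes their number by at most one,
  and a band between two components merges two loops.  There are at most \<open>\<bar>V\<bar>\<close> loops when \<open>T\<close>
  is empty and at least as many as faces when \<open>T\<close> is everything, so Euler's formula shows that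
  there is exactly one loop iff \<open>T\<close> is a spanning tree.  Since \<open>\<bar>T\<bar> = \<bar>V\<bar> - 1\<close> is then fixed and
  \<open>A\<^sup>4 = -1\<close>, the state of \<open>T\<close> contributes \<open>(-1)\<^sup>m\<close> up to a common factor of modulus one, where
  \<open>m\<close> is the number of negative edges in \<open>T\<close>.  The Fourier-Hadamard transform at \<open>\<^bold>v\<close> is the sum
  of the same signs.
\<close>

section \<open>Counting equivalence classes\<close>

text \<open>Each class is recorded as the value at \<open>x\<close> of the map to
  \<open>r\<^sup>*\<close>-classes, so comparing numbers of classes becomes comparing images of
  functions on \<open>X\<close>.\<close>

definition num_classes :: "'a set \<Rightarrow> ('a \<times> 'a) set \<Rightarrow> nat" where
  "num_classes X r = card ((\<lambda>x. r\<^sup>* `` {x}) ` X)"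

lemma rtrancl_invariant:
  assumes "(x, y) \<in> r\<^sup>*" and "\<And>x y. (x, y) \<in> r \<Longrightarrow> g x = g y"
  shows "g x = g y"
  using assms(1) by induction (auto dest: assms(2))

lemma class_eq_iff:
  assumes "sym r"
  shows "r\<^sup>* `` {x} = r\<^sup>* `` {y} \<longleftrightarrow> (x, y) \<in> r\<^sup>*"
  using sym_rtrancl[OF assms] by (auto dest: symD intro: rtrancl_trans)

text \<open>On \<open>X\<close> the map \<open>h\<close> factors through \<open>g\<close>: compose
  \<open>h\<close> with a choice of preimages under \<open>g\<close>.\<close>

lemma card_image_factor_le:
  assumes "finite X" and "\<And>x y. x \<in> X \<Longrightarrow> y \<in> X \<Longrightarrow> g x = g y \<Longrightarrow> h x = h y"
  shows "card (h ` X) \<le> card (g ` X)"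
proof -
  have "h ` X = (\<lambda>z. h (inv_into X g z)) ` g ` X"
    unfolding image_image
    by (intro image_cong refl assms(2)) (simp_all add: inv_into_into f_inv_into_f)
  then show ?thesis
    using assms(1) by (metis card_image_le finite_imageI)
qed

text \<open>Source of the lower bounds: a quantity that is constant along \<open>r\<close> takes one
  value per class.\<close>

lemma card_image_le_num_classes:
  assumes "finite X" and "sym r" and "\<And>x y. (x, y) \<in> r \<Longrightarrow> g x = g y"
  shows "card (g ` X) \<le> num_classes X r"
  unfolding num_classes_def
  by (rule card_image_factor_le)
    (auto simp: assms(1) class_eq_iff[OF assms(2)] dest: rtrancl_invariant[OF _ assms(3)])

text \<open>Source of the upper bounds: here each value of \<open>g\<close> determines the
  class.\<close>

lemma num_classes_le_card_image:
  assumes "finite X" and "sym r"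
    and "\<And>x y. x \<in> X \<Longrightarrow> y \<in> X \<Longrightarrow> g x = g y \<Longrightarrow> (x, y) \<in> r\<^sup>*"
  shows "num_classes X r \<le> card (g ` X)"
  unfolding num_classes_def
  by (rule card_image_factor_le) (use assms in \<open>auto simp: class_eq_iff\<close>)

lemma num_classes_antimono:
  assumes "finite X" and "sym r" "sym s" and "r \<subseteq> s\<^sup>*"
  shows "num_classes X s \<le> num_classes X r"
  unfolding num_classes_def[of X s]
  using assms by (intro card_image_le_num_classes) (auto simp: class_eq_iff)

text \<open>Redirecting the \<open>r\<close>-class of \<open>y\<close> to that of \<open>x\<close>
  gives an invariant of \<open>r'\<close> that loses at most one value.\<close>

lemma num_classes_add_pair:
  assumes "finite X" and "sym r" and r': "r' \<subseteq> r \<union> {(x, y), (y, x)}" "sym r'"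
  shows "num_classes X r \<le> num_classes X r' + 1"
proof -
  let ?q = "\<lambda>z. r\<^sup>* `` {z}"
  define g where "g z = (if ?q z = ?q y then ?q x else ?q z)" for z
  have "?q ` X \<subseteq> insert (?q y) (g ` X)"
    by (auto simp: g_def)
  then have "num_classes X r \<le> card (insert (?q y) (g ` X))"
    unfolding num_classes_def using assms(1) by (intro card_mono) auto
  also have "\<dots> \<le> Suc (card (g ` X))"
    by (rule card_insert_le_m1) auto
  also have "card (g ` X) \<le> num_classes X r'"
  proof (rule card_image_le_num_classes)
    fix a b assume "(a, b) \<in> r'"
    then consider "(a, b) \<in> r" | "a = x \<and> b = y \<or> a = y \<and> b = x"
      using r' by auto
    then show "g a = g b"
    proof cases
      case 1
      then have "?q a = ?q b" by (simp add: class_eq_iff[OF assms(2)] r_into_rtrancl)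
      then show ?thesis by (simp add: g_def)
    qed (auto simp: g_def)
  qed (use assms in auto)
  finally show ?thesis by simp
qed

text \<open>Every \<open>s\<close>-class has a representative outside the \<open>r\<close>-class of
  \<open>x\<close>, because \<open>y\<close> can stand in for the points of that class. So the
  \<open>r\<close>-class of \<open>x\<close> is surplus.\<close>

lemma num_classes_merge:
  assumes "finite X" and "sym r" "sym s" and "r \<subseteq> s\<^sup>*"
    and "x \<in> X" "y \<in> X" and "(x, y) \<notin> r\<^sup>*" "(x, y) \<in> s\<^sup>*"
  shows "num_classes X s + 1 \<le> num_classes X r"
proof -
  let ?q = "\<lambda>z. r\<^sup>* `` {z}" and ?p = "\<lambda>z. s\<^sup>* `` {z}"
  have le: "r\<^sup>* \<subseteq> s\<^sup>*"
    using assms(4) by (metis rtrancl_idemp rtrancl_mono)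
  let ?Y = "{z \<in> X. ?q z \<noteq> ?q x}"
  have pX: "?p ` X = ?p ` ?Y"
  proof (intro equalityI subsetI)
    fix P assume "P \<in> ?p ` X"
    then obtain z where z: "z \<in> X" "P = ?p z" by auto
    show "P \<in> ?p ` ?Y"
    proof (cases "?q z = ?q x")
      case True
      then have "(z, x) \<in> s\<^sup>*"
        using le by (auto simp: class_eq_iff assms(2))
      then have "P = ?p y"
        using z assms(8) by (auto simp: class_eq_iff assms(3) intro: rtrancl_trans)
      moreover have "y \<in> ?Y"
        using assms class_eq_iff[of r x y] by auto
      ultimately show ?thesis by blast
    qed (use z in auto)
  qed auto
  have "card (?p ` ?Y) \<le> card (?q ` ?Y)"
    by (rule card_image_factor_le) (use assms le in \<open>auto simp: class_eq_iff\<close>)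
  moreover have "?q x \<in> ?q ` X" "?q x \<notin> ?q ` ?Y"
    using assms(5) by auto
  then have "card (?q ` ?Y) < card (?q ` X)"
    by (intro psubset_card_mono) (use assms(1) in auto)
  ultimately show ?thesis
    unfolding num_classes_def pX by linarith
qed

text \<open>The orbits have size two and are removed one at a time. This is the parity argument for
  arcs that leave a crossing which has been cut open.\<close>

lemma even_card_fixpoint_free_involution:
  assumes "finite A" and "\<And>x. x \<in> A \<Longrightarrow> f x \<in> A \<and> f x \<noteq> x \<and> f (f x) = x"
  shows "even (card A)"
  using assms
proof (induction "card A" arbitrary: A rule: less_induct)
  case less
  show ?case
  proof (cases "A = {}")
    case False
    then obtain x where x: "x \<in> A" by blast
    let ?B = "A - {x, f x}"
    have fx: "f x \<in> A" "f x \<noteq> x" using less.prems(2)[OF x] by auto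
    have "card {x, f x} \<le> card A"
      using x fx less.prems(1) by (intro card_mono) auto
    then have c: "card A = card ?B + 2"
      using x fx less.prems(1) by (simp add: card_Diff_subset)
    have "even (card ?B)"
    proof (rule less.hyps)
      fix y assume y: "y \<in> ?B"
      then show "f y \<in> ?B \<and> f y \<noteq> y \<and> f (f y) = y"
        using less.prems(2)[of y] less.prems(2)[OF x] by auto
    qed (use c less.prems(1) in auto)
    then show ?thesis using c by simp
  qed simp
qed

section \<open>Connectivity and undirected cycles\<close>

text \<open>Adjacency in the spanning subgraph with edge set \<open>T\<close>. Working with
  relations makes the components of different subgraphs comparable by inclusion.\<close>

definition edge_rel :: "('v, 'e) pre_digraph \<Rightarrow> 'e set \<Rightarrow> ('v \<times> 'v) set" where
  "edge_rel G T = (\<Union>e\<in>T. {(tail G e, head G e), (head G e, tail G e)})"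

lemma sym_edge_rel: "sym (edge_rel G T)"
  by (auto simp: edge_rel_def sym_def)

lemma edge_rel_mono: "S \<subseteq> T \<Longrightarrow> edge_rel G S \<subseteq> edge_rel G T"
  by (auto simp: edge_rel_def)

lemma edge_rel_insert:
  "edge_rel G (insert e T) = edge_rel G T \<union> {(tail G e, head G e), (head G e, tail G e)}"
  by (auto simp: edge_rel_def)

lemma edge_rel_rtrancl_sym: "(u, v) \<in> (edge_rel G T)\<^sup>* \<Longrightarrow> (v, u) \<in> (edge_rel G T)\<^sup>*"
  by (rule symD[OF sym_rtrancl[OF sym_edge_rel]])

section \<open>From walks and connectedness of digraphs to relations on vertices\<close>

lemma bidirect_restrict_arcs [simp]:
  "verts (bidirect (G\<lparr>arcs := T\<rparr>)) = verts G"
  "arcs (bidirect (G\<lparr>arcs := T\<rparr>)) = T \<times> UNIV"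
  "tail (bidirect (G\<lparr>arcs := T\<rparr>)) = tail (bidirect G)"
  "head (bidirect (G\<lparr>arcs := T\<rparr>)) = head (bidirect G)"
  by (auto simp: bidirect_def)

context wf_digraph
begin

lemma wf_digraph_bidirect: "wf_digraph (bidirect G)"
  by unfold_locales (auto simp: bidirect_def split: if_splits)

lemma wf_digraph_restrict_arcs: "T \<subseteq> arcs G \<Longrightarrow> wf_digraph (G\<lparr>arcs := T\<rparr>)"
  by unfold_locales auto

lemma rtrancl_on_edge_rel:
  assumes "T \<subseteq> arcs G" and "u \<in> verts G" "v \<in> verts G"
  shows "(u, v) \<in> rtrancl_on (verts G) (edge_rel G T) \<longleftrightarrow> (u, v) \<in> (edge_rel G T)\<^sup>*"
  using assms
  by (auto simp: edge_rel_def intro: rtrancl_on_rtranclI intro!: rtrancl_consistent_rtrancl_on)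

text \<open>Connectedness is strong connectedness of the symmetric closure, whose arcs are exactly
  \<open>edge_rel G T\<close>.\<close>

lemma connected_restrict_arcs_iff:
  assumes "T \<subseteq> arcs G"
  shows "Digraph_Component.connected (G\<lparr>arcs := T\<rparr>) \<longleftrightarrow>
    verts G \<noteq> {} \<and> (\<forall>u\<in>verts G. \<forall>v\<in>verts G. (u, v) \<in> (edge_rel G T)\<^sup>*)"
proof -
  have "parcs (mk_symmetric (G\<lparr>arcs := T\<rparr>)) = edge_rel G T"
    "pverts (mk_symmetric (G\<lparr>arcs := T\<rparr>)) = verts G"
    by (auto simp: mk_symmetric_def edge_rel_def)
  then show ?thesis
    by (auto simp: Digraph_Component.connected_def strongly_connected_def reachable_def
        rtrancl_on_edge_rel[OF assms])
qed

lemma arcs_ends_bidirect: "arcs_ends (bidirect (G\<lparr>arcs := T\<rparr>)) = edge_rel G T"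
  by (force simp: arcs_ends_conv bidirect_def edge_rel_def)

lemma reachable_bidirect_iff:
  assumes "T \<subseteq> arcs G" and "u \<in> verts G" "v \<in> verts G"
  shows "u \<rightarrow>\<^sup>*\<^bsub>bidirect (G\<lparr>arcs := T\<rparr>)\<^esub> v \<longleftrightarrow> (u, v) \<in> (edge_rel G T)\<^sup>*"
  unfolding reachable_def arcs_ends_bidirect
  using rtrancl_on_edge_rel[OF assms] by (simp add: bidirect_def)

end

text \<open>Two darts of one edge have the same pair of ends, so a repeated edge would make the path
  revisit a vertex. This supplies the distinctness of edges that \<open>undirected_cycle\<close>
  asks for.\<close>

lemma (in wf_digraph) apath_distinct_edges:
  assumes "pre_digraph.apath (bidirect G) u p v"
  shows "distinct (map fst p)"
proof -
  interpret B: wf_digraph "bidirect G" by (rule wf_digraph_bidirect)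
  from assms show ?thesis
  proof (induction p arbitrary: u)
    case (Cons d p)
    then have p: "B.apath (head (bidirect G) d) p v"
      and u: "tail (bidirect G) d \<notin> set (B.awalk_verts (head (bidirect G) d) p)"
      by (auto simp: B.apath_Cons_iff)
    have "fst d \<noteq> fst d'" if "d' \<in> set p" for d'
    proof
      assume eq: "fst d = fst d'"
      have "B.awalk (head (bidirect G) d) p v" using p by (simp add: B.apath_def)
      then have "tail (bidirect G) d' \<in> set (B.awalk_verts (head (bidirect G) d) p)"
        "head (bidirect G) d' \<in> set (B.awalk_verts (head (bidirect G) d) p)"
        using that by (auto simp: B.set_awalk_verts)
      moreover have "tail (bidirect G) d \<in> {tail (bidirect G) d', head (bidirect G) d'}"
        using eq by (auto simp: bidirect_def split: prod.splits if_splits)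
      ultimately show False using u by auto
    qed
    then show ?case using Cons.IH[OF p] by auto
  qed simp
qed

text \<open>A simple path in \<open>T\<close> from the head of \<open>e\<close> back to its tail,
  preceded by the dart \<open>(e, False)\<close>, would be an undirected cycle; for a loop the path
  is empty.\<close>

lemma (in wf_digraph) disconnected_if_acyclic:
  assumes T: "insert e T \<subseteq> arcs G" "e \<notin> T"
    and acyclic: "\<nexists>p. undirected_cycle (G\<lparr>arcs := insert e T\<rparr>) p"
  shows "(tail G e, head G e) \<notin> (edge_rel G T)\<^sup>*"
proof
  assume "(tail G e, head G e) \<in> (edge_rel G T)\<^sup>*"
  then have *: "(head G e, tail G e) \<in> (edge_rel G T)\<^sup>*"
    by (rule edge_rel_rtrancl_sym)
  interpret T: wf_digraph "G\<lparr>arcs := T\<rparr>" using T by (intro wf_digraph_restrict_arcs) auto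
  interpret B: wf_digraph "bidirect (G\<lparr>arcs := T\<rparr>)" by (rule T.wf_digraph_bidirect)
  interpret T': wf_digraph "G\<lparr>arcs := insert e T\<rparr>" using T by (intro wf_digraph_restrict_arcs) auto
  interpret B': wf_digraph "bidirect (G\<lparr>arcs := insert e T\<rparr>)" by (rule T'.wf_digraph_bidirect)
  obtain p where p: "B.apath (head G e) p (tail G e)"
    using * T by (subst (asm) reachable_bidirect_iff[symmetric]) (auto simp: B.reachable_apath)
  \<comment> \<open>The two dart digraphs differ only in their arc sets, so walks visit the same
    vertices and satisfy the same chaining condition in both.\<close>
  have cas: "B'.cas u q v = B.cas u q v" for u q v
    by (induction q arbitrary: u) (simp_all add: B.cas.simps B'.cas.simps)
  have verts: "B'.awalk_verts u q = B.awalk_verts u q" for u q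
    by (induction q arbitrary: u) simp_all
  have mem: "set p \<subseteq> T \<times> UNIV"
    using p by (auto simp: B.apath_def B.awalk_def)
  have "B'.awalk (tail G e) ((e, False) # p) (tail G e)"
    using p T mem
    by (auto simp: B'.awalk_def B.apath_def B.awalk_def cas B'.cas.simps bidirect_def[of G])
  moreover have "distinct (tl (B'.awalk_verts (tail G e) ((e, False) # p)))"
    using p by (simp add: verts B.apath_def bidirect_def[of G])
  ultimately have "B'.cycle ((e, False) # p)"
    unfolding B'.cycle_def by blast
  moreover have "distinct (map fst ((e, False) # p))"
    using T.apath_distinct_edges[OF p] mem T(2) by auto
  ultimately show False
    using acyclic by (auto simp: undirected_cycle_def)
qed

text \<open>The rest of the cycle joins the ends of its first edge without using that edge, so
  deleting it keeps all components.\<close>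

lemma (in wf_digraph) undirected_cycle_obtains_redundant_edge:
  assumes "T \<subseteq> arcs G" and "undirected_cycle (G\<lparr>arcs := T\<rparr>) p"
  obtains e where "e \<in> T" "(edge_rel G T)\<^sup>* = (edge_rel G (T - {e}))\<^sup>*"
proof -
  interpret T: wf_digraph "G\<lparr>arcs := T\<rparr>" using assms(1) by (rule wf_digraph_restrict_arcs)
  interpret B: wf_digraph "bidirect (G\<lparr>arcs := T\<rparr>)" by (rule T.wf_digraph_bidirect)
  obtain u where "B.awalk u p u" "p \<noteq> []" and dist: "distinct (map fst p)"
    using assms(2) by (auto simp: undirected_cycle_def B.cycle_def)
  then obtain d q where p: "p = d # q" and w: "B.awalk (head (bidirect G) d) q u"
    and u: "u = tail (bidirect G) d" and d: "fst d \<in> T"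
    by (cases p) (auto simp: B.awalk_Cons_iff)
  let ?T = "T - {fst d}"
  interpret T': wf_digraph "G\<lparr>arcs := ?T\<rparr>" using assms(1) by (intro wf_digraph_restrict_arcs) auto
  interpret B': wf_digraph "bidirect (G\<lparr>arcs := ?T\<rparr>)" by (rule T'.wf_digraph_bidirect)
  have cas: "B'.cas u q v = B.cas u q v" for u q v
    by (induction q arbitrary: u) (simp_all add: B.cas.simps B'.cas.simps)
  have "set q \<subseteq> T \<times> UNIV"
    using w by (simp add: B.awalk_def)
  \<comment> \<open>Distinctness of the edges excludes a return along the same edge, as in a dart
    followed by its reverse.\<close>
  moreover have "fst d \<notin> fst ` set q"
    using dist by (simp add: p)
  ultimately have "set q \<subseteq> ?T \<times> UNIV"
    by (fastforce simp: image_iff)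
  then have "B'.awalk (head (bidirect G) d) q u"
    using w by (auto simp: B'.awalk_def B.awalk_def cas)
  then have "(head (bidirect G) d, u) \<in> (edge_rel G ?T)\<^sup>*"
    using B'.reachable_awalkI[THEN reachable_rtranclI] by (simp add: arcs_ends_bidirect)
  then have "(head G (fst d), tail G (fst d)) \<in> (edge_rel G ?T)\<^sup>*
      \<or> (tail G (fst d), head G (fst d)) \<in> (edge_rel G ?T)\<^sup>*"
    by (auto simp: u bidirect_def[of G] split: prod.splits if_splits)
  then have "{(tail G (fst d), head G (fst d)), (head G (fst d), tail G (fst d))}
      \<subseteq> (edge_rel G ?T)\<^sup>*"
    by (auto dest: edge_rel_rtrancl_sym)
  moreover have "edge_rel G T
      = edge_rel G ?T \<union> {(tail G (fst d), head G (fst d)), (head G (fst d), tail G (fst d))}"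
    using d edge_rel_insert[of G "fst d" ?T] by (simp add: insert_absorb)
  ultimately have "edge_rel G T \<subseteq> (edge_rel G ?T)\<^sup>*" by auto
  moreover have "edge_rel G ?T \<subseteq> edge_rel G T" by (rule edge_rel_mono) auto
  ultimately show thesis
    using that[OF d] by (metis rtrancl_subset)
qed

section \<open>States of the medial diagram\<close>

text \<open>A state described independently of the signs: \<open>T\<close> is the set of edges that
  carry a band, where the two black regions are merged.\<close>

definition smooth_bands :: "'e set \<Rightarrow> 'e \<times> compass \<Rightarrow> 'e \<times> compass" where
  "smooth_bands T = (\<lambda>(e, x). (e, if e \<in> T then join_WE x else join_NS x))"

lemma smooth_bands_involution:
  "fst (smooth_bands T h) = fst h" "smooth_bands T h \<noteq> h" "smooth_bands T (smooth_bands T h) = h"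
proof -
  obtain e x where "h = (e, x)" by fastforce
  then show "fst (smooth_bands T h) = fst h" "smooth_bands T h \<noteq> h"
    "smooth_bands T (smooth_bands T h) = h"
    by (cases x; simp add: smooth_bands_def)+
qed

lemma after_end_cases:
  obtains d where "fst d = fst h" "h = after_end d" | d where "fst d = fst h" "h = before_end d"
proof -
  obtain e x where "h = (e, x)" by fastforce
  then show thesis
    using that(1)[of "(e, False)"] that(1)[of "(e, True)"]
      that(2)[of "(e, False)"] that(2)[of "(e, True)"]
    by (cases x) (auto simp: after_end_def before_end_def)
qed

lemma fst_corner_ends [simp]: "fst (after_end d) = fst d" "fst (before_end d) = fst d"
  by (simp_all add: after_end_def before_end_def)

lemma medial_glue_corner_ends:
  "medial_glue \<sigma> (after_end d) = before_end (\<sigma> d)"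
  "medial_glue \<sigma> (before_end d) = after_end (inv \<sigma> d)"
  by (cases d; auto simp: after_end_def before_end_def)+

text \<open>Without a band the strand crosses \<open>d\<close> to its other flank; with a band it
  runs along the side of the edge to the opposite dart.\<close>

lemma smooth_bands_corner_ends:
  "fst d \<notin> T \<Longrightarrow> smooth_bands T (after_end d) = before_end d"
  "fst d \<notin> T \<Longrightarrow> smooth_bands T (before_end d) = after_end d"
  "fst d \<in> T \<Longrightarrow> smooth_bands T (after_end d) = before_end (dart_rev d)"
  "fst d \<in> T \<Longrightarrow> smooth_bands T (before_end d) = after_end (dart_rev d)"
  by (cases d; auto simp: smooth_bands_def after_end_def before_end_def dart_rev_def)+

text \<open>The vertex in the black region that the strand end borders.\<close>

definition end_vertex :: "('v, 'e) pre_digraph \<Rightarrow> 'e \<times> compass \<Rightarrow> 'v" where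
  "end_vertex G = (\<lambda>(e, x). if x \<in> {NW, SW} then tail G e else head G e)"

lemma end_vertex_corner_ends:
  "end_vertex G (after_end d) = tail (bidirect G) d"
  "end_vertex G (before_end d) = tail (bidirect G) d"
  by (auto simp: end_vertex_def after_end_def before_end_def bidirect_def split: prod.splits)

section \<open>Darts, strand ends and gluing of a plane graph\<close>

locale plane_graph =
  fixes G :: "('v, 'e) pre_digraph" and \<sigma> :: "'e \<times> bool \<Rightarrow> 'e \<times> bool"
  assumes plane: "connected_plane_graph G \<sigma>"
begin

sublocale fin_digraph G
  using plane by (simp add: connected_plane_graph_def)

abbreviation ends :: "('e \<times> compass) set" where
  "ends \<equiv> arcs G \<times> UNIV"

abbreviation darts :: "('e \<times> bool) set" where
  "darts \<equiv> arcs G \<times> UNIV"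

lemma finite_ends: "finite ends"
proof -
  have "finite (UNIV :: compass set)"
    by (rule finite_subset[of _ "{NE, NW, SW, SE}"]) (use compass.exhaust in auto)
  then show ?thesis by simp
qed

lemma permutes_darts: "\<sigma> permutes darts"
  using plane by (simp add: connected_plane_graph_def rotation_system_def bidirect_def)

lemma in_out_arcs: "d \<in> out_arcs (bidirect G) v \<longleftrightarrow> d \<in> darts \<and> tail (bidirect G) d = v"
  by (auto simp: bidirect_def)

lemma cyclic_on_out_arcs:
  assumes "d \<in> darts"
  shows "cyclic_on \<sigma> (out_arcs (bidirect G) (tail (bidirect G) d))"
proof -
  have "tail (bidirect G) d \<in> verts G"
    using assms by (auto simp: bidirect_def)
  moreover have "d \<in> out_arcs (bidirect G) (tail (bidirect G) d)"
    using assms by (simp only: in_out_arcs)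
  ultimately show ?thesis
    using plane unfolding connected_plane_graph_def rotation_system_def by blast
qed

lemma tail_rotation:
  assumes "d \<in> darts"
  shows "tail (bidirect G) (\<sigma> d) = tail (bidirect G) d"
    "tail (bidirect G) (inv \<sigma> d) = tail (bidirect G) d"
proof -
  have *: "tail (bidirect G) (\<sigma> d) = tail (bidirect G) d" if "d \<in> darts" for d
    using cyclic_on_inI[OF cyclic_on_out_arcs[OF that]] that by (metis in_out_arcs)
  show "tail (bidirect G) (\<sigma> d) = tail (bidirect G) d" by (rule *) fact
  have "inv \<sigma> d \<in> darts"
    using assms permutes_in_image[OF permutes_inv[OF permutes_darts]] by blast
  from *[OF this] show "tail (bidirect G) (inv \<sigma> d) = tail (bidirect G) d"
    using permutes_inverses[OF permutes_darts] by simp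
qed

lemma medial_glue_involution:
  assumes "h \<in> ends"
  shows "medial_glue \<sigma> h \<in> ends" "medial_glue \<sigma> h \<noteq> h" "medial_glue \<sigma> (medial_glue \<sigma> h) = h"
  using wf_medial_diagram[OF plane] assms
  by (auto simp: wf_diagram_def strand_ends_def medial_diagram_def)

text \<open>An edge of the medial graph cuts off one corner, whose two darts start at the same
  vertex.\<close>

lemma end_vertex_medial_glue:
  assumes "h \<in> ends"
  shows "end_vertex G (medial_glue \<sigma> h) = end_vertex G h"
proof (cases rule: after_end_cases[of h])
  case (1 d)
  then have "d \<in> darts" using assms by (simp add: mem_Times_iff)
  then show ?thesis
    by (simp add: 1(2) medial_glue_corner_ends end_vertex_corner_ends tail_rotation)
next
  case (2 d)
  then have "d \<in> darts" using assms by (simp add: mem_Times_iff)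
  then show ?thesis
    by (simp add: 2(2) medial_glue_corner_ends end_vertex_corner_ends tail_rotation)
qed

section \<open>Loops of a state and the effect of adding one band\<close>

definition state_rel :: "'e set \<Rightarrow> (('e \<times> compass) \<times> ('e \<times> compass)) set" where
  "state_rel T = {(h, k). h \<in> ends \<and> (k = medial_glue \<sigma> h \<or> k = smooth_bands T h)}"

lemma state_relI:
  "h \<in> ends \<Longrightarrow> (h, medial_glue \<sigma> h) \<in> state_rel T"
  "h \<in> ends \<Longrightarrow> (h, smooth_bands T h) \<in> state_rel T"
  by (auto simp: state_rel_def)

lemma smooth_bands_in_ends: "h \<in> ends \<Longrightarrow> smooth_bands T h \<in> ends"
  by (simp add: mem_Times_iff smooth_bands_involution)

lemma sym_state_rel: "sym (state_rel T)"
proof (rule symI)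
  fix h k assume "(h, k) \<in> state_rel T"
  then have "h \<in> ends" and "k = medial_glue \<sigma> h \<or> k = smooth_bands T h"
    by (simp_all add: state_rel_def)
  then show "(k, h) \<in> state_rel T"
    using state_relI[of k T] medial_glue_involution[of h] smooth_bands_in_ends[of h T]
      smooth_bands_involution(3)[of T h] by metis
qed

text \<open>Linking the two strands at \<open>e\<close> that border the band puts all four ends
  there in one class. The result is at least as coarse as the state without the band, and one added
  pair costs at most one class.\<close>

lemma state_rel_toggle_le:
  assumes "e \<in> arcs G" "e \<notin> T"
  shows "num_classes ends (state_rel (insert e T)) \<le> num_classes ends (state_rel T) + 1"
proof -
  let ?r = "state_rel (insert e T)"
  let ?r' = "?r \<union> {((e, NE), (e, SE)), ((e, SE), (e, NE))}"
  have s: "sym ?r'"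
    using sym_state_rel[of "insert e T"] by (auto simp: sym_def)
  have WE: "((e, x), (e, join_WE x)) \<in> ?r'" for x
    using assms by (auto simp: state_rel_def smooth_bands_def)
  have NS: "((e, x), (e, join_NS x)) \<in> ?r'\<^sup>*" for x
  proof -
    have r: "((e, NE), (e, NW)) \<in> ?r'" "((e, NW), (e, NE)) \<in> ?r'"
      "((e, SE), (e, SW)) \<in> ?r'" "((e, SW), (e, SE)) \<in> ?r'"
      using WE[of NE] WE[of NW] WE[of SE] WE[of SW] by auto
    have "((e, NW), (e, SW)) \<in> ?r'\<^sup>*"
      by (rule rtrancl_trans[OF r_into_rtrancl[OF r(2)]], rule converse_rtrancl_into_rtrancl[of _ "(e, SE)"])
        (use r in auto)
    moreover have "((e, SW), (e, NW)) \<in> ?r'\<^sup>*"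
      by (rule rtrancl_trans[OF r_into_rtrancl[OF r(4)]], rule converse_rtrancl_into_rtrancl[of _ "(e, NE)"])
        (use r in auto)
    ultimately show ?thesis by (cases x) auto
  qed
  have "num_classes ends ?r \<le> num_classes ends ?r' + 1"
    by (rule num_classes_add_pair[OF finite_ends sym_state_rel subset_refl s])
  also have "num_classes ends ?r' \<le> num_classes ends (state_rel T)"
  proof (rule num_classes_antimono[OF finite_ends sym_state_rel s], rule subrelI)
    fix h k assume "(h, k) \<in> state_rel T"
    then consider "(h, k) \<in> ?r" | "fst h = e" "k = smooth_bands T h"
      by (cases "fst h = e") (auto simp: state_rel_def smooth_bands_def)
    then show "(h, k) \<in> ?r'\<^sup>*"
    proof cases
      case 2
      then show ?thesis
        using NS[of "snd h"] assms by (cases h) (simp add: smooth_bands_def)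
    qed auto
  qed
  finally show ?thesis by simp
qed

text \<open>Cut the state open at the crossing \<open>e\<close>.  By parity every remaining arc that starts at one of the
  four ends at \<open>e\<close> also finishes at one of them.  If the two strands at \<open>e\<close> lie on different
  loops, each arc therefore closes up its own strand, and smoothing the other way joins the two.\<close>

lemma state_rel_merge:
  assumes e: "e \<in> arcs G" "e \<notin> T" and sep: "((e, NE), (e, NW)) \<notin> (state_rel T)\<^sup>*"
  shows "num_classes ends (state_rel (insert e T)) + 1 \<le> num_classes ends (state_rel T)"
proof -
  \<comment> \<open>The state cut open at \<open>e\<close>: gluing everywhere, smoothing only at the
    other crossings.\<close>
  define r where
    "r = {(h, k). h \<in> ends \<and> (k = medial_glue \<sigma> h \<or> fst h \<noteq> e \<and> k = smooth_bands T h)}"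
  have r_le: "r \<subseteq> state_rel T" "r \<subseteq> state_rel (insert e T)"
    by (auto simp: r_def state_rel_def smooth_bands_def)
  have r_ends: "k \<in> ends" if "(h, k) \<in> r" for h k
    using that medial_glue_involution(1)[of h] smooth_bands_in_ends[of h]
    by (auto simp only: r_def mem_Collect_eq case_prod_conv)
  have NS: "((e, x), (e, join_NS x)) \<in> state_rel T" for x
    using e by (auto simp: state_rel_def smooth_bands_def)
  \<comment> \<open>The strands at \<open>e\<close> join \<open>NE\<close> to \<open>SE\<close> and
    \<open>NW\<close> to \<open>SW\<close> and lie on different loops, so ends at \<open>e\<close>
    on one loop belong to one strand.\<close>
  have side: "x \<in> {NE, SE} \<longleftrightarrow> y \<in> {NE, SE}" if xy: "((e, x), (e, y)) \<in> (state_rel T)\<^sup>*" for x y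
  proof (rule ccontr)
    assume neq: "\<not> ?thesis"
    have yx: "((e, y), (e, x)) \<in> (state_rel T)\<^sup>*"
      using symD[OF sym_rtrancl[OF sym_state_rel] xy] .
    obtain a b where ab: "((e, a), (e, b)) \<in> (state_rel T)\<^sup>*" "a \<in> {NE, SE}" "b \<in> {NW, SW}"
    proof (cases "x \<in> {NE, SE}")
      case True
      then have "y \<in> {NW, SW}" using neq by (cases y) auto
      then show ?thesis using that xy True by blast
    next
      case False
      then have "x \<in> {NW, SW}" using neq by (cases x) auto
      moreover have "y \<in> {NE, SE}" using neq False by blast
      ultimately show ?thesis using that yx by blast
    qed
    have "((e, NE), (e, a)) \<in> (state_rel T)\<^sup>*" "((e, b), (e, NW)) \<in> (state_rel T)\<^sup>*"
      using ab(2,3) NS[of NE] NS[of SW] by auto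
    then show False using ab(1) sep by (meson rtrancl_trans)
  qed
  have arc: "((e, x), (e, join_NS x)) \<in> r\<^sup>*" for x
  proof (rule ccontr)
    assume contra: "((e, x), (e, join_NS x)) \<notin> r\<^sup>*"
    \<comment> \<open>The arc of the cut-open state through \<open>(e, x)\<close>. Gluing pairs off
      all of \<open>C\<close>, smoothing only its ends away from \<open>e\<close>, so
      \<open>(e, x)\<close> cannot be its only end at \<open>e\<close>.\<close>
    define C where "C = r\<^sup>* `` {(e, x)}"
    have "C \<subseteq> ends"
    proof
      fix k assume "k \<in> C"
      then have "((e, x), k) \<in> r\<^sup>*" by (simp add: C_def)
      then show "k \<in> ends"
        by induction (use e r_ends in auto)
    qed
    then have fin: "finite C" using finite_ends finite_subset by blast
    have glue: "medial_glue \<sigma> h \<in> C" and smooth: "fst h \<noteq> e \<Longrightarrow> smooth_bands T h \<in> C"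
      if "h \<in> C" for h
    proof -
      have "(h, medial_glue \<sigma> h) \<in> r" "fst h \<noteq> e \<Longrightarrow> (h, smooth_bands T h) \<in> r"
        using that \<open>C \<subseteq> ends\<close> by (auto simp only: r_def mem_Collect_eq case_prod_conv)
      then show "medial_glue \<sigma> h \<in> C" "fst h \<noteq> e \<Longrightarrow> smooth_bands T h \<in> C"
        using that by (auto simp only: C_def Image_singleton_iff intro: rtrancl_into_rtrancl)
    qed
    have even: "even (card C)" "even (card {h \<in> C. fst h \<noteq> e})"
    proof (rule even_card_fixpoint_free_involution[OF fin])
      fix h assume "h \<in> C"
      then show "medial_glue \<sigma> h \<in> C \<and> medial_glue \<sigma> h \<noteq> h \<and> medial_glue \<sigma> (medial_glue \<sigma> h) = h"
        using \<open>C \<subseteq> ends\<close> medial_glue_involution[of h] glue[of h] by blast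
    next
      show "even (card {h \<in> C. fst h \<noteq> e})"
      proof (rule even_card_fixpoint_free_involution)
        fix h assume "h \<in> {h \<in> C. fst h \<noteq> e}"
        then show "smooth_bands T h \<in> {h \<in> C. fst h \<noteq> e} \<and> smooth_bands T h \<noteq> h
            \<and> smooth_bands T (smooth_bands T h) = h"
          using smooth[of h] by (simp add: smooth_bands_involution)
      qed (use fin in auto)
    qed
    have "C = insert (e, x) {h \<in> C. fst h \<noteq> e}"
    proof -
      have "y = x" if "(e, y) \<in> C" for y
      proof -
        have "((e, x), (e, y)) \<in> r\<^sup>*" using that by (simp add: C_def)
        then have "x \<in> {NE, SE} \<longleftrightarrow> y \<in> {NE, SE}" "y \<noteq> join_NS x"
          using side rtrancl_mono[OF r_le(1)] contra by auto
        then show ?thesis by (cases x; cases y) auto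
      qed
      then have "h = (e, x)" if "h \<in> C" "fst h = e" for h
        using that by (cases h) simp
      moreover have "(e, x) \<in> C" by (simp add: C_def)
      ultimately show ?thesis by blast
    qed
    then have "card C = card (insert (e, x) {h \<in> C. fst h \<noteq> e})"
      by (rule arg_cong)
    also have "\<dots> = Suc (card {h \<in> C. fst h \<noteq> e})"
      by (rule card_insert_disjoint) (use fin in auto)
    finally show False using even by simp
  qed
  show ?thesis
  proof (rule num_classes_merge[OF finite_ends sym_state_rel sym_state_rel _ _ _ sep])
    show "state_rel T \<subseteq> (state_rel (insert e T))\<^sup>*"
    proof (rule subrelI)
      fix h k assume "(h, k) \<in> state_rel T"
      then consider "(h, k) \<in> r" | "fst h = e" "k = smooth_bands T h"
        by (auto simp: state_rel_def r_def)
      then show "(h, k) \<in> (state_rel (insert e T))\<^sup>*"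
      proof cases
        case 2
        then have "(h, k) \<in> r\<^sup>*"
          using arc[of "snd h"] e by (cases h) (simp add: smooth_bands_def)
        then show ?thesis using rtrancl_mono[OF r_le(2)] by auto
      qed (use r_le(2) in auto)
    qed
    show "((e, NE), (e, NW)) \<in> (state_rel (insert e T))\<^sup>*"
      using e by (auto simp: state_rel_def smooth_bands_def)
  qed (use e in auto)
qed

text \<open>Without bands a loop alternately crosses a dart and moves on to the next one in the
  rotation. The rotation is cyclic on the darts at a vertex, so one loop collects all ends
  there.\<close>

lemma num_classes_no_bands:
  "num_classes ends (state_rel {}) \<le> card (end_vertex G ` ends)"
proof (rule num_classes_le_card_image[OF finite_ends sym_state_rel])
  let ?R = "(state_rel {})\<^sup>*"
  have sym: "(y, x) \<in> ?R" if "(x, y) \<in> ?R" for x y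
    using symD[OF sym_rtrancl[OF sym_state_rel] that] .
  have after: "(before_end d, after_end d) \<in> ?R" "(after_end d, before_end (\<sigma> d)) \<in> ?R"
    if "d \<in> darts" for d
  proof -
    have "before_end d \<in> ends" "after_end d \<in> ends" using that by (simp_all add: mem_Times_iff)
    then show "(before_end d, after_end d) \<in> ?R" "(after_end d, before_end (\<sigma> d)) \<in> ?R"
      using state_relI(2)[of "before_end d" "{}"] state_relI(1)[of "after_end d" "{}"]
      by (simp_all add: smooth_bands_corner_ends medial_glue_corner_ends r_into_rtrancl)
  qed
  have orbit: "(before_end d, before_end d') \<in> ?R" if d: "d \<in> darts" and "d' \<in> orbit \<sigma> d" for d d'
    using that(2)
  proof induction
    case base
    show ?case using after[OF d] by (rule rtrancl_trans)
  next
    case (step d')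
    then have "d' \<in> darts" using permutes_orbit_subset[OF permutes_darts d] by blast
    from after[OF this] have "(before_end d', before_end (\<sigma> d')) \<in> ?R" by (rule rtrancl_trans)
    with step.IH show ?case by (rule rtrancl_trans)
  qed
  have before: "\<exists>d\<in>darts. end_vertex G h = tail (bidirect G) d \<and> (h, before_end d) \<in> ?R"
    if h: "h \<in> ends" for h
  proof (cases rule: after_end_cases[of h])
    case (1 d)
    then have "d \<in> darts" using h by (simp add: mem_Times_iff)
    then show ?thesis
      using sym[OF after(1)] 1(2) by (intro bexI[of _ d]) (auto simp: end_vertex_corner_ends)
  next
    case (2 d)
    then have "d \<in> darts" using h by (simp add: mem_Times_iff)
    then show ?thesis
      using 2(2) by (intro bexI[of _ d]) (auto simp: end_vertex_corner_ends)
  qed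
  fix h k assume hk: "h \<in> ends" "k \<in> ends" "end_vertex G h = end_vertex G k"
  obtain c where c: "c \<in> darts" "end_vertex G h = tail (bidirect G) c" "(h, before_end c) \<in> ?R"
    using before[OF hk(1)] by (elim bexE conjE)
  obtain d where d: "d \<in> darts" "end_vertex G k = tail (bidirect G) d" "(k, before_end d) \<in> ?R"
    using before[OF hk(2)] by (elim bexE conjE)
  have "d \<in> out_arcs (bidirect G) (tail (bidirect G) c)"
    "c \<in> out_arcs (bidirect G) (tail (bidirect G) c)"
    using c d hk(3) by (simp_all only: in_out_arcs)
  then have "d \<in> orbit \<sigma> c"
    using orbit_cyclic_eq3[OF cyclic_on_out_arcs[OF c(1)]] by simp
  from c(3) orbit[OF c(1) this] sym[OF d(3)] show "(h, k) \<in> ?R"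
    by (meson rtrancl_trans)
qed

lemma dart_rev_darts: "d \<in> darts \<Longrightarrow> dart_rev d \<in> darts"
  by (simp add: dart_rev_def mem_Times_iff)

text \<open>An \<open>orbit\<close> starts at the image of its point, so \<open>d\<close> must first
  be shown to lie on its own orbit. It does because the face step permutes the finite set of
  darts.\<close>

lemma orbit_face_step:
  assumes "d \<in> darts"
  shows "orbit (\<sigma> \<circ> dart_rev) (\<sigma> (dart_rev d)) = orbit (\<sigma> \<circ> dart_rev) d"
proof -
  let ?f = "\<sigma> \<circ> dart_rev"
  \<comment> \<open>Off the darts \<open>\<sigma> \<circ> dart_rev\<close> still reverses and is not
    the identity, so it has to be restricted before \<open>permutes\<close> applies.\<close>
  let ?p = "perm_restrict ?f darts"
  have f: "?f d \<in> darts" if "d \<in> darts" for d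
    using permutes_in_image[OF permutes_darts] dart_rev_darts[OF that] by simp
  have "inj dart_rev"
    by (rule injI) (simp add: dart_rev_def prod_eq_iff)
  with permutes_inj[OF permutes_darts] have "inj ?f"
    by (rule inj_compose)
  then have "inj_on ?p darts"
    by (simp add: inj_on_def perm_restrict_def)
  moreover have "?p ` darts \<subseteq> darts"
    using f by (intro image_subsetI) (simp only: perm_restrict_simps)
  moreover have fin: "finite darts"
    using finite_arcs by simp
  ultimately have "bij_betw ?p darts darts"
    by (simp only: bij_betw_def endo_inj_surj)
  then have "?p permutes darts"
    by (rule bij_imp_permutes) (rule perm_restrict_simps(2))
  then have "permutation ?p"
    unfolding permutation_permutes using fin by (intro exI[of _ darts] conjI)
  then have "d \<in> orbit ?p d"
    by (rule permutation_self_in_orbit)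
  also have "orbit ?p d = orbit ?f d"
  proof (rule orbit_cong0[OF assms])
    show "?p \<in> darts \<rightarrow> darts"
      using f by (intro Pi_I) (simp only: perm_restrict_simps)
  qed (simp only: perm_restrict_simps)
  finally show ?thesis
    using self_in_orbit_step[of d ?f] by simp
qed

text \<open>With all bands present the loops run along face boundaries, so the face is an invariant
  of the loop. The edgeless graph has a face but no strand ends.\<close>

lemma num_faces_le_all_bands:
  assumes "arcs G \<noteq> {}"
  shows "num_faces G \<sigma> \<le> num_classes ends (state_rel (arcs G))"
proof -
  let ?o = "orbit (\<sigma> \<circ> dart_rev)"
  \<comment> \<open>The face at an end: \<open>before_end d\<close> gets the face of
    \<open>d\<close>, and \<open>after_end d\<close> that of \<open>\<sigma> d\<close>, since it
    lies in the same corner as \<open>before_end (\<sigma> d)\<close>.\<close>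
  define g where "g = (\<lambda>(e, x). case x of SW \<Rightarrow> ?o (e, False) | NE \<Rightarrow> ?o (e, True)
    | NW \<Rightarrow> ?o (\<sigma> (e, False)) | SE \<Rightarrow> ?o (\<sigma> (e, True)))"
  have g: "g (before_end d) = ?o d" "g (after_end d) = ?o (\<sigma> d)" for d
    by (cases d; auto simp: g_def before_end_def after_end_def)+
  have inv: "g h = g k" if "(h, k) \<in> state_rel (arcs G)" for h k
  proof (cases rule: after_end_cases[of h])
    case (1 d)
    then have d: "d \<in> darts" using that by (auto simp: state_rel_def mem_Times_iff)
    have "fst d \<in> arcs G" "k = medial_glue \<sigma> h \<or> k = smooth_bands (arcs G) h"
      using that d by (simp_all add: state_rel_def mem_Times_iff)
    then have "k = before_end (\<sigma> d) \<or> k = before_end (dart_rev d)"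
      using 1(2) by (simp add: medial_glue_corner_ends smooth_bands_corner_ends)
    moreover have "?o (\<sigma> d) = ?o (dart_rev d)"
      using orbit_face_step[OF dart_rev_darts[OF d]] by (simp add: dart_rev_def)
    ultimately show ?thesis unfolding 1(2) by (elim disjE) (simp_all only: g)
  next
    case (2 d)
    then have d: "d \<in> darts" using that by (auto simp: state_rel_def mem_Times_iff)
    have "fst d \<in> arcs G" "k = medial_glue \<sigma> h \<or> k = smooth_bands (arcs G) h"
      using that d by (simp_all add: state_rel_def mem_Times_iff)
    then have "k = after_end (inv \<sigma> d) \<or> k = after_end (dart_rev d)"
      using 2(2) by (simp add: medial_glue_corner_ends smooth_bands_corner_ends)
    then show ?thesis
      unfolding 2(2)
      by (elim disjE) (simp_all only: g orbit_face_step[OF d] permutes_inverses[OF permutes_darts])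
  qed
  have "face_cycles G \<sigma> \<subseteq> g ` ends"
  proof
    fix F assume "F \<in> face_cycles G \<sigma>"
    then obtain d where "d \<in> darts" "F = ?o d"
      by (auto simp: face_cycles_def bidirect_def)
    then show "F \<in> g ` ends"
      by (intro image_eqI[of _ _ "before_end d"]) (simp_all add: g mem_Times_iff)
  qed
  then have "card (face_cycles G \<sigma>) \<le> card (g ` ends)"
    using finite_ends by (intro card_mono) auto
  also have "\<dots> \<le> num_classes ends (state_rel (arcs G))"
    by (rule card_image_le_num_classes[OF finite_ends sym_state_rel inv])
  finally show ?thesis using assms by (simp add: num_faces_def)
qed

section \<open>Loop counts, crossing-free circles included\<close>

definition isolated_verts :: "'v set" where
  "isolated_verts = {v \<in> verts G. out_arcs (bidirect G) v = {}}"

definition state_loops :: "'e set \<Rightarrow> nat" where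
  "state_loops T = card isolated_verts + num_classes ends (state_rel T)"

text \<open>An A-smoothing merges the black regions exactly at the positive edges, a B-smoothing
  exactly at the others.\<close>

lemma num_loops_medial_diagram:
  "num_loops (medial_diagram G \<sigma> \<chi>) S = state_loops {e \<in> arcs G. e \<in> S \<longleftrightarrow> \<chi> e = 1}"
proof -
  let ?D = "medial_diagram G \<sigma> \<chi>"
  have "{(h, k). h \<in> strand_ends ?D \<and> (k = glue ?D h \<or> k = smooth ?D S h)}
      = state_rel {e \<in> arcs G. e \<in> S \<longleftrightarrow> \<chi> e = 1}"
    by (auto simp: strand_ends_def medial_diagram_def smooth_def state_rel_def smooth_bands_def)
  then show ?thesis
    by (simp add: num_loops_def state_loops_def num_classes_def quotient_def UNION_singleton_eq_range
        isolated_verts_def strand_ends_def)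
      (simp add: medial_diagram_def)
qed

lemma end_vertex_image: "end_vertex G ` ends = verts G - isolated_verts"
proof (intro equalityI subsetI)
  fix v assume "v \<in> end_vertex G ` ends"
  then obtain h where h: "h \<in> ends" "v = end_vertex G h" by blast
  obtain d where "d \<in> darts" "v = tail (bidirect G) d"
    by (cases rule: after_end_cases[of h])
      (use h in \<open>auto simp: end_vertex_corner_ends mem_Times_iff\<close>)
  then have "d \<in> out_arcs (bidirect G) v" "v \<in> verts G"
    by (auto simp: bidirect_def)
  then show "v \<in> verts G - isolated_verts"
    unfolding isolated_verts_def by blast
next
  fix v assume "v \<in> verts G - isolated_verts"
  then obtain d where "d \<in> out_arcs (bidirect G) v"
    unfolding isolated_verts_def by blast
  then have "d \<in> darts" "tail (bidirect G) d = v"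
    by (simp_all only: in_out_arcs)
  then show "v \<in> end_vertex G ` ends"
    by (intro image_eqI[of _ _ "after_end d"]) (simp_all add: end_vertex_corner_ends mem_Times_iff)
qed

lemma isolated_verts_subset: "isolated_verts \<subseteq> verts G"
  by (auto simp: isolated_verts_def)

lemma state_loops_empty_le: "state_loops {} \<le> card (verts G)"
  using num_classes_no_bands isolated_verts_subset
  by (simp add: state_loops_def end_vertex_image card_Diff_subset finite_subset card_mono
      le_diff_conv2)

text \<open>Gluing stays at a vertex, and smoothing changes the vertex only along a band. Hence each
  loop stays in one component.\<close>

lemma state_rel_connects:
  assumes "(h, k) \<in> state_rel T"
  shows "(end_vertex G h, end_vertex G k) \<in> (edge_rel G T)\<^sup>*"
proof -
  obtain e x where h: "h = (e, x)" by fastforce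
  show ?thesis
  proof (cases "k = medial_glue \<sigma> h")
    case True
    then show ?thesis
      using assms end_vertex_medial_glue[of h] by (simp add: state_rel_def)
  next
    case False
    then have k: "k = smooth_bands T h" using assms by (simp add: state_rel_def)
    show ?thesis
    proof (cases "e \<in> T")
      case True
      then have "(tail G e, head G e) \<in> edge_rel G T" "(head G e, tail G e) \<in> edge_rel G T"
        by (auto simp: edge_rel_def)
      then show ?thesis
        using True by (cases x) (auto simp: h k smooth_bands_def end_vertex_def)
    qed (cases x, auto simp: h k smooth_bands_def end_vertex_def)
  qed
qed

lemma state_rel_invariant_component:
  assumes "(h, k) \<in> state_rel T"
  shows "(edge_rel G T)\<^sup>* `` {end_vertex G h} = (edge_rel G T)\<^sup>* `` {end_vertex G k}"
  using state_rel_connects[OF assms] by (simp add: class_eq_iff sym_edge_rel)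

text \<open>Every component contains an isolated vertex or the vertex of a strand end, and the
  component is constant along loops.\<close>

lemma components_le_state_loops: "num_classes (verts G) (edge_rel G T) \<le> state_loops T"
proof -
  let ?q = "\<lambda>v. (edge_rel G T)\<^sup>* `` {v}"
  have "verts G = isolated_verts \<union> end_vertex G ` ends"
    using end_vertex_image isolated_verts_subset by blast
  then have "?q ` verts G = ?q ` (isolated_verts \<union> end_vertex G ` ends)"
    by (rule arg_cong)
  also have "\<dots> = ?q ` isolated_verts \<union> (\<lambda>h. ?q (end_vertex G h)) ` ends"
    by (simp only: image_Un image_image)
  finally have "num_classes (verts G) (edge_rel G T)
      \<le> card (?q ` isolated_verts) + card ((\<lambda>h. ?q (end_vertex G h)) ` ends)"
    unfolding num_classes_def by (simp only: card_Un_le)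
  also have "\<dots> \<le> card isolated_verts + num_classes ends (state_rel T)"
  proof (rule add_mono)
    show "card (?q ` isolated_verts) \<le> card isolated_verts"
      using isolated_verts_subset by (intro card_image_le) (auto intro: finite_subset)
    show "card ((\<lambda>h. ?q (end_vertex G h)) ` ends) \<le> num_classes ends (state_rel T)"
      by (rule card_image_le_num_classes[OF finite_ends sym_state_rel])
        (rule state_rel_invariant_component)
  qed
  finally show ?thesis by (simp add: state_loops_def)
qed

text \<open>Without edges each vertex is its own component, and an added edge lowers the number of
  components by at most one.\<close>

lemma card_verts_le_components:
  assumes "finite T"
  shows "card (verts G) \<le> num_classes (verts G) (edge_rel G T) + card T"
  using assms
proof induction
  case empty
  have "card (id ` verts G) \<le> num_classes (verts G) (edge_rel G {})"
    by (rule card_image_le_num_classes) (auto simp: edge_rel_def sym_def)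
  then show ?case by simp
next
  case (insert e T)
  have "num_classes (verts G) (edge_rel G T) \<le> num_classes (verts G) (edge_rel G (insert e T)) + 1"
    by (rule num_classes_add_pair[OF finite_verts sym_edge_rel equalityD1[OF edge_rel_insert] sym_edge_rel])
  then show ?case using insert by simp
qed

lemma state_loops_Un_le:
  assumes "finite U" and "T \<union> U \<subseteq> arcs G"
  shows "state_loops (T \<union> U) \<le> state_loops T + card U"
  using assms
proof induction
  case (insert e U)
  have "state_loops (insert e (T \<union> U)) \<le> state_loops (T \<union> U) + 1"
    using state_rel_toggle_le[of e "T \<union> U"] insert.prems
    by (cases "e \<in> T \<union> U") (auto simp: state_loops_def insert_absorb)
  then show ?case using insert by simp
qed simp

text \<open>The edges are added one at a time. Each joins different components of those already
  present, so \<open>NE\<close> and \<open>NW\<close> at its crossing lie on different loops and the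
  band merges them.\<close>

lemma state_loops_independent_le:
  assumes "finite T" and "T \<subseteq> arcs G"
    and "\<And>e. e \<in> T \<Longrightarrow> (tail G e, head G e) \<notin> (edge_rel G (T - {e}))\<^sup>*"
  shows "state_loops T + card T \<le> card (verts G)"
  using assms
proof induction
  case empty
  show ?case using state_loops_empty_le by simp
next
  case (insert e T)
  have "(tail G a, head G a) \<notin> (edge_rel G (T - {a}))\<^sup>*" if "a \<in> T" for a
    using insert.prems(2)[of a] that rtrancl_mono[OF edge_rel_mono[of "T - {a}" "insert e T - {a}" G]]
    by blast
  then have IH: "state_loops T + card T \<le> card (verts G)"
    using insert.IH insert.prems(1) by simp
  have "((e, NE), (e, NW)) \<notin> (state_rel T)\<^sup>*"
  proof
    assume "((e, NE), (e, NW)) \<in> (state_rel T)\<^sup>*"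
    from rtrancl_invariant[OF this, of "\<lambda>h. (edge_rel G T)\<^sup>* `` {end_vertex G h}",
        OF state_rel_invariant_component]
    have "(tail G e, head G e) \<in> (edge_rel G T)\<^sup>*"
      by (simp add: end_vertex_def class_eq_iff sym_edge_rel edge_rel_rtrancl_sym)
    then show False using insert.prems(2)[of e] insert.hyps by simp
  qed
  then have "state_loops (insert e T) + 1 \<le> state_loops T"
    using state_rel_merge[of e T] insert by (simp add: state_loops_def)
  then show ?case using IH insert.hyps by simp
qed

section \<open>One-loop states and spanning trees\<close>

lemma verts_nonempty: "verts G \<noteq> {}"
  using plane by (auto simp: connected_plane_graph_def Digraph_Component.connected_def
      strongly_connected_def mk_symmetric_def)

lemma state_loops_pos: "state_loops T \<ge> 1"
proof -
  have "num_classes (verts G) (edge_rel G T) \<noteq> 0"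
    using verts_nonempty by (simp add: num_classes_def)
  then show ?thesis using components_le_state_loops[of T] by linarith
qed

text \<open>Connectedness gives \<open>card (verts G) \<le> card T + 1\<close>. Adding the missing
  edges creates at most one loop each and ends with at least one loop per face, so Euler's formula
  gives the opposite bound.\<close>

lemma card_one_loop_state:
  assumes T: "T \<subseteq> arcs G" and one: "state_loops T = 1"
  shows "card T + 1 = card (verts G)"
proof -
  have fin: "finite T" using T finite_arcs finite_subset by blast
  have "card (verts G) \<le> 1 + card T"
    using card_verts_le_components[OF fin] components_le_state_loops[of T] one by linarith
  moreover have "num_faces G \<sigma> \<le> state_loops (arcs G)"
    using num_faces_le_all_bands state_loops_pos[of "arcs G"]
    by (cases "arcs G = {}") (auto simp: num_faces_def state_loops_def)
  moreover have "state_loops (arcs G) \<le> 1 + card (arcs G - T)"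
    using state_loops_Un_le[of "arcs G - T" T] T one by (simp add: Un_absorb1)
  moreover have "card (arcs G - T) = card (arcs G) - card T" "card T \<le> card (arcs G)"
    using T by (auto simp: card_Diff_subset fin card_mono)
  moreover have "card (verts G) + num_faces G \<sigma> = card (arcs G) + 2"
    using plane by (simp add: connected_plane_graph_def)
  ultimately show ?thesis by linarith
qed

text \<open>One loop forces connectedness, and a cycle would allow a connected subgraph with too few
  edges. For a tree, connectedness fixes the least number of edges, and adding them as merging bands
  leaves at most one loop.\<close>

lemma one_loop_state_iff_spanning_tree:
  assumes T: "T \<subseteq> arcs G"
  shows "state_loops T = 1 \<longleftrightarrow> T \<in> spanning_trees G"
proof
  have fin: "finite T" using T finite_arcs finite_subset by blast
  {
    assume one: "state_loops T = 1"
    then have "num_classes (verts G) (edge_rel G T) \<le> Suc 0"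
      using components_le_state_loops[of T] by simp
    then have "(u, v) \<in> (edge_rel G T)\<^sup>*" if "u \<in> verts G" "v \<in> verts G" for u v
      using that by (auto simp: num_classes_def card_le_Suc0_iff_eq class_eq_iff[OF sym_edge_rel])
    then have conn: "Digraph_Component.connected (G\<lparr>arcs := T\<rparr>)"
      using verts_nonempty by (simp add: connected_restrict_arcs_iff[OF T])
    have "\<not> undirected_cycle (G\<lparr>arcs := T\<rparr>) p" for p
    proof
      assume "undirected_cycle (G\<lparr>arcs := T\<rparr>) p"
      then obtain e where e: "e \<in> T" "(edge_rel G T)\<^sup>* = (edge_rel G (T - {e}))\<^sup>*"
        using undirected_cycle_obtains_redundant_edge[OF T] by blast
      then have "num_classes (verts G) (edge_rel G (T - {e})) \<le> 1"
        using components_le_state_loops[of T] one by (simp add: num_classes_def)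
      moreover have "card (verts G) \<le> num_classes (verts G) (edge_rel G (T - {e})) + card (T - {e})"
        using fin by (intro card_verts_le_components) simp
      moreover have "card (T - {e}) < card T"
        using e(1) fin by (intro psubset_card_mono) auto
      ultimately show False
        using card_one_loop_state[OF T one] by linarith
    qed
    then show "T \<in> spanning_trees G"
      using T conn by (simp add: spanning_trees_def)
  next
    assume tree: "T \<in> spanning_trees G"
    then have "(u, v) \<in> (edge_rel G T)\<^sup>*" if "u \<in> verts G" "v \<in> verts G" for u v
      using that by (simp add: spanning_trees_def connected_restrict_arcs_iff[OF T])
    then have "num_classes (verts G) (edge_rel G T) \<le> Suc 0"
      by (auto simp: num_classes_def card_le_Suc0_iff_eq class_eq_iff[OF sym_edge_rel])
    then have "card (verts G) \<le> 1 + card T"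
      using card_verts_le_components[OF fin] by linarith
    moreover have "state_loops T + card T \<le> card (verts G)"
    proof (rule state_loops_independent_le[OF fin T])
      fix e assume "e \<in> T"
      then have "insert e (T - {e}) = T" by blast
      then show "(tail G e, head G e) \<notin> (edge_rel G (T - {e}))\<^sup>*"
        using disconnected_if_acyclic[of e "T - {e}"] tree T by (simp add: spanning_trees_def)
    qed
    ultimately show "state_loops T = 1"
      using state_loops_pos[of T] by linarith
  }
qed

end

section \<open>The Kauffman bracket at the zero of the loop value\<close>

lemma laurent_eval_superset:
  assumes "finite K" and "Poly_Mapping.keys p \<subseteq> K"
  shows "laurent_eval p z = (\<Sum>k\<in>K. of_int (Poly_Mapping.lookup p k) * z powi k)"
  unfolding laurent_eval_def using assms
  by (intro sum.mono_neutral_left) (auto simp: in_keys_iff)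

lemma laurent_eval_add: "laurent_eval (p + q) z = laurent_eval p z + laurent_eval q z"
proof -
  let ?K = "Poly_Mapping.keys p \<union> Poly_Mapping.keys q"
  have "laurent_eval r z = (\<Sum>k\<in>?K. of_int (Poly_Mapping.lookup r k) * z powi k)"
    if "r \<in> {p, q, p + q}" for r
    using that keys_add[of p q] by (intro laurent_eval_superset) auto
  then show ?thesis
    by (simp add: lookup_add algebra_simps sum.distrib)
qed

lemma laurent_eval_0 [simp]: "laurent_eval 0 z = 0"
  by (simp add: laurent_eval_def)

lemma laurent_eval_single [simp]:
  "laurent_eval (Poly_Mapping.single k a) z = of_int a * z powi k"
  by (subst laurent_eval_superset[of "{k}"]) auto

lemma laurent_eval_uminus: "laurent_eval (- p) z = - laurent_eval p z"
  using laurent_eval_add[of p "- p" z] by (simp add: eq_neg_iff_add_eq_0 add.commute)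

lemma laurent_eval_sum: "laurent_eval (\<Sum>i\<in>I. f i) z = (\<Sum>i\<in>I. laurent_eval (f i) z)"
  by (induction I rule: infinite_finite_induct) (simp_all add: laurent_eval_add)

lemma laurent_sum_monomials:
  "(p :: laurent) = (\<Sum>k\<in>Poly_Mapping.keys p. Poly_Mapping.single k (Poly_Mapping.lookup p k))"
  by (intro poly_mapping_eqI) (auto simp: lookup_sum lookup_single when_def in_keys_iff)

lemma laurent_eval_mult:
  assumes "z \<noteq> 0"
  shows "laurent_eval (p * q) z = laurent_eval p z * laurent_eval q z"
proof -
  let ?P = "Poly_Mapping.keys p" and ?Q = "Poly_Mapping.keys q"
  let ?m = "\<lambda>p k. Poly_Mapping.single k (Poly_Mapping.lookup p k) :: laurent"
  have "laurent_eval ((\<Sum>k\<in>?P. ?m p k) * (\<Sum>l\<in>?Q. ?m q l)) z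
      = laurent_eval (\<Sum>k\<in>?P. ?m p k) z * laurent_eval (\<Sum>l\<in>?Q. ?m q l) z"
    using assms
    by (simp add: sum_product laurent_eval_sum mult_single power_int_add mult_ac)
  then show ?thesis
    by (simp flip: laurent_sum_monomials)
qed

lemma laurent_eval_power:
  assumes "z \<noteq> 0"
  shows "laurent_eval (p ^ m) z = laurent_eval p z ^ m"
proof (induction m)
  case 0
  show ?case using laurent_eval_single[of 0 1 z] by (simp flip: single_one)
qed (simp add: laurent_eval_mult assms)

text \<open>\<open>map_key\<close> reads only the coefficients at exponents \<open>- 2 * k\<close>,
  so evenness of all exponents ensures that no term is lost.\<close>

lemma laurent_eval_map_key:
  assumes "\<And>k. k \<in> Poly_Mapping.keys p \<Longrightarrow> even k"
  shows "laurent_eval (Poly_Mapping.map_key (\<lambda>k. - 2 * k) p) (z powi (- 2)) = laurent_eval p z"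
proof -
  let ?f = "\<lambda>k :: int. - 2 * k"
  have inj: "inj ?f" by (auto intro: injI)
  have "Poly_Mapping.keys p = ?f ` (?f -` Poly_Mapping.keys p)"
    using assms by (fastforce simp: image_iff elim!: evenE intro: exI[of _ "- x" for x])
  then have "laurent_eval p z = (\<Sum>k\<in>?f ` (?f -` Poly_Mapping.keys p).
      of_int (Poly_Mapping.lookup p k) * z powi k)"
    by (simp add: laurent_eval_def)
  also have "\<dots> = laurent_eval (Poly_Mapping.map_key ?f p) (z powi (- 2))"
    unfolding laurent_eval_def keys_map_key[OF inj]
    by (subst sum.reindex) (auto simp: inj_on_def map_key.rep_eq[OF inj] simp flip: power_int_mult)
  finally show ?thesis by simp
qed

section \<open>Parity of the exponents in the Jones polynomial\<close>

lemma writhe_parity: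
  assumes "finite (crossings D)"
  shows "even (writhe D out) \<longleftrightarrow> even (card (crossings D))"
proof -
  have "odd (crossing_sign D out c)" for c by (simp add: crossing_sign_def)
  then show ?thesis by (simp add: writhe_def even_sum_iff assms)
qed

text \<open>The exponent \<open>card S - card (crossings D - S)\<close> has the parity of the number
  of crossings, and powers of the loop value have only even exponents.\<close>

lemma keys_kauffman_bracket_parity:
  assumes "finite (crossings D)" and "k \<in> Poly_Mapping.keys (kauffman_bracket D)"
  shows "even k \<longleftrightarrow> even (card (crossings D))"
proof -
  let ?\<delta> = "- Poly_Mapping.single 2 1 - Poly_Mapping.single (- 2) 1 :: laurent"
  have "Poly_Mapping.keys ?\<delta> \<subseteq> {2, - 2}"
    using keys_diff[of "- Poly_Mapping.single 2 1 :: laurent" "Poly_Mapping.single (- 2) 1"] by auto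
  then have base: "even k" if "k \<in> Poly_Mapping.keys ?\<delta>" for k
    using that by auto
  have pow: "even k" if "k \<in> Poly_Mapping.keys (?\<delta> ^ m)" for k m
    using that
  proof (induction m arbitrary: k)
    case (Suc m)
    then show ?case
      using keys_mult[of ?\<delta> "?\<delta> ^ m"] base by fastforce
  qed simp
  obtain S where S: "S \<subseteq> crossings D" and k: "k \<in> Poly_Mapping.keys
      (Poly_Mapping.single (int (card S) - int (card (crossings D - S))) 1 *
       ?\<delta> ^ (num_loops D S - 1))"
    using subsetD[OF keys_sum assms(2)[unfolded kauffman_bracket_def]] by blast
  obtain l where "k = int (card S) - int (card (crossings D - S)) + l" "even l"
    using subsetD[OF keys_mult k] pow by auto
  moreover have "card (crossings D) = card S + card (crossings D - S)"
    using S assms(1) by (metis card_Diff_subset card_mono finite_subset le_add_diff_inverse)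
  ultimately show ?thesis by simp
qed

text \<open>The value of \<open>A\<close> whose power \<open>- 2\<close> is the point i used in
  \<open>link_det\<close>.\<close>

definition bracket_point :: complex where
  "bracket_point = cis (- pi / 4)"

lemma bracket_point:
  "bracket_point \<noteq> 0" "cmod bracket_point = 1"
  "bracket_point powi 2 = - \<i>" "bracket_point powi (- 2) = \<i>" "bracket_point powi 4 = - 1"
proof -
  show "bracket_point \<noteq> 0" "cmod bracket_point = 1"
    by (simp_all add: bracket_point_def)
  have "bracket_point ^ 2 = cis (- (pi / 2))"
    by (simp add: bracket_point_def Complex.DeMoivre)
  then have sq: "bracket_point ^ 2 = - \<i>"
    by (simp add: complex_eq_iff)
  show 2: "bracket_point powi 2 = - \<i>" using sq by simp
  show "bracket_point powi (- 2) = \<i>"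
    by (simp only: power_int_minus 2) simp
  have "bracket_point powi 4 = (bracket_point powi 2) ^ 2"
    by (simp add: power_int_power')
  then show "bracket_point powi 4 = - 1" unfolding 2 by simp
qed

text \<open>Writhe and bracket exponents agree in parity, so their product has even exponents and
  keeps its value under the change of variable. The writhe factor has modulus one.\<close>

lemma link_det_eq_bracket:
  assumes "finite (crossings D)"
  shows "link_det D out = cmod (laurent_eval (kauffman_bracket D) bracket_point)"
proof -
  let ?u = "Poly_Mapping.single (- 3 * writhe D out) ((- 1) ^ nat \<bar>writhe D out\<bar>) :: laurent"
  have "even k" if k: "k \<in> Poly_Mapping.keys (?u * kauffman_bracket D)" for k
  proof -
    obtain l where "k = - 3 * writhe D out + l" "l \<in> Poly_Mapping.keys (kauffman_bracket D)"
      using k keys_mult[of ?u "kauffman_bracket D"] by (auto split: if_splits)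
    then show ?thesis
      using keys_kauffman_bracket_parity[OF assms] writhe_parity[OF assms, of out] by simp
  qed
  from laurent_eval_map_key[OF this, where z = bracket_point]
  have "laurent_eval (jones_polynomial D out) \<i>
      = laurent_eval ?u bracket_point * laurent_eval (kauffman_bracket D) bracket_point"
    by (simp only: jones_polynomial_def bracket_point(4) laurent_eval_mult[OF bracket_point(1)])
  moreover have "cmod (laurent_eval ?u bracket_point) = 1"
    by (simp add: norm_mult norm_power norm_power_int bracket_point)
  ultimately show ?thesis
    by (simp add: link_det_def norm_mult)
qed

text \<open>The loop value is zero at \<open>bracket_point\<close>, so a state with \<open>m\<close>
  loops gets the factor \<open>0 ^ (m - 1)\<close>.\<close>

lemma bracket_eval:
  assumes "finite (crossings D)" and pos: "\<And>S. S \<subseteq> crossings D \<Longrightarrow> num_loops D S \<ge> 1"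
  shows "laurent_eval (kauffman_bracket D) bracket_point
    = (\<Sum>S | S \<subseteq> crossings D \<and> num_loops D S = 1.
        bracket_point powi (int (card S) - int (card (crossings D - S))))"
proof -
  have \<delta>: "laurent_eval (- Poly_Mapping.single 2 1 - Poly_Mapping.single (- 2) 1) bracket_point = 0"
    by (simp only: diff_conv_add_uminus laurent_eval_add laurent_eval_uminus laurent_eval_single
        bracket_point) simp
  have "laurent_eval (kauffman_bracket D) bracket_point
      = (\<Sum>S\<in>Pow (crossings D). bracket_point powi (int (card S) - int (card (crossings D - S)))
          * 0 ^ (num_loops D S - 1))"
    by (simp only: kauffman_bracket_def laurent_eval_sum laurent_eval_mult[OF bracket_point(1)]
        laurent_eval_power[OF bracket_point(1)] \<delta> laurent_eval_single of_int_1 mult_1)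
  also have "\<dots> = (\<Sum>S | S \<subseteq> crossings D \<and> num_loops D S = 1.
        bracket_point powi (int (card S) - int (card (crossings D - S))))"
  proof (rule sum.mono_neutral_cong_right)
    show "\<forall>S\<in>Pow (crossings D) - {S. S \<subseteq> crossings D \<and> num_loops D S = 1}.
      bracket_point powi (int (card S) - int (card (crossings D - S))) * 0 ^ (num_loops D S - 1) = 0"
    proof
      fix S assume "S \<in> Pow (crossings D) - {S. S \<subseteq> crossings D \<and> num_loops D S = 1}"
      \<comment> \<open>Positivity matters here: a state with no loop would get the factor
        \<open>0 ^ 0 = 1\<close> by truncated subtraction.\<close>
      then have "num_loops D S - 1 \<noteq> 0" using pos[of S] by auto
      then show "bracket_point powi (int (card S) - int (card (crossings D - S)))
          * 0 ^ (num_loops D S - 1) = 0"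
        by (simp add: power_0_left)
    qed
  qed (use assms in auto)
  finally show ?thesis .
qed

section \<open>Evaluation of the Fourier-Hadamard polynomial\<close>

lemma inj_char_vec: "inj char_vec"
  by (rule injI) (auto simp: char_vec_def fun_eq_iff split: if_splits)

lemma cube_eq_char_vec: "cube n = char_vec ` Pow {1..n}"
proof (intro equalityI subsetI)
  fix x assume "x \<in> cube n"
  then have "x = char_vec {i. x i = 1}" "{i. x i = 1} \<subseteq> {1..n}"
    by (auto simp: cube_def char_vec_def fun_eq_iff)
  then show "x \<in> char_vec ` Pow {1..n}" by blast
qed (auto simp: cube_def char_vec_def)

text \<open>The monomial of \<open>B\<close> is one at the indicator of \<open>A\<close> if
  \<open>B \<subseteq> A\<close> and zero otherwise, with \<open>0 ^ 0 = 1\<close> at indices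
  outside both.\<close>

lemma multilinear_eval_char_vec:
  assumes "A \<subseteq> {1..n}"
  shows "multilinear_eval n l (\<lambda>i. of_bool (char_vec A i = 1)) = (\<Sum>B\<in>Pow A. l (char_vec B))"
proof -
  have "(\<Prod>i\<in>{1..n}. of_bool (char_vec A i = 1) ^ of_bool (char_vec B i = 1)) = (of_bool (B \<subseteq> A) :: real)"
    if "B \<subseteq> {1..n}" for B
  proof (cases "B \<subseteq> A")
    case True
    then show ?thesis by (auto simp: char_vec_def intro!: prod.neutral)
  next
    case False
    then obtain i where "i \<in> B" "i \<notin> A" by blast
    then have "\<exists>i\<in>{1..n}. of_bool (char_vec A i = 1) ^ of_bool (char_vec B i = 1) = (0 :: real)"
      using that by (intro bexI[of _ i]) (auto simp: char_vec_def)
    then show ?thesis using False by (simp add: prod_zero)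
  qed
  then have "multilinear_eval n l (\<lambda>i. of_bool (char_vec A i = 1))
      = (\<Sum>B\<in>Pow {1..n}. l (char_vec B) * of_bool (B \<subseteq> A))"
    unfolding multilinear_eval_def cube_eq_char_vec
    by (subst sum.reindex) (auto intro: inj_on_subset[OF inj_char_vec])
  also have "\<dots> = (\<Sum>B\<in>Pow A. l (char_vec B))"
    by (rule sum.mono_neutral_cong_right) (use assms in auto)
  finally show ?thesis .
qed

text \<open>Interpolation prescribes the subset sums of the coefficients. Moebius inversion on the
  subset lattice yields exactly one solution, so the definite description in \<open>nnf\<close>
  denotes it.\<close>

lemma nnf_interpolates:
  assumes "A \<subseteq> {1..n}"
  shows "multilinear_eval n (nnf n F) (\<lambda>i. of_bool (char_vec A i = 1)) = F (char_vec A)"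
proof -
  let ?P = "\<lambda>l. (\<forall>y. y \<notin> cube n \<longrightarrow> l y = 0) \<and>
     (\<forall>x \<in> cube n. multilinear_eval n l (\<lambda>i. of_bool (x i = 1)) = F x)"
  have P_iff: "?P l \<longleftrightarrow> (\<forall>y. y \<notin> cube n \<longrightarrow> l y = 0) \<and>
      (\<forall>A. A \<subseteq> {1..n} \<longrightarrow> (\<Sum>B\<in>Pow A. l (char_vec B)) = F (char_vec A))" for l
    by (auto simp: cube_eq_char_vec multilinear_eval_char_vec)
  have "\<exists>!l. ?P l"
    unfolding P_iff
  proof (rule ex_ex1I)
    \<comment> \<open>The coefficient at \<open>B\<close> is the sum of
      \<open>(- 1) ^ (card B + card T) * F (char_vec T)\<close> over \<open>T \<subseteq> B\<close>,
      split into two sign twists to fit symmetric inclusion-exclusion.\<close>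
    define g where "g S = (\<Sum>T\<in>Pow S. (- 1) ^ card T * F (char_vec T))" for S
    define l where "l y = (if y \<in> cube n then (- 1) ^ card {i. y i = 1} * g {i. y i = 1} else 0)" for y
    have ones: "{i. char_vec B i = 1} = B" for B
      by (auto simp: char_vec_def)
    have "(\<Sum>B\<in>Pow A. l (char_vec B)) = F (char_vec A)" if A: "A \<subseteq> {1..n}" for A
    proof -
      have "l (char_vec B) = (- 1) ^ card B * g B" if "B \<in> Pow A" for B
        using that A by (auto simp: l_def ones cube_eq_char_vec)
      then have "(\<Sum>B\<in>Pow A. l (char_vec B)) = (\<Sum>B\<in>Pow A. (- 1) ^ card B * g B)"
        by (intro sum.cong) auto
      also have "\<dots> = F (char_vec A)"
        by (rule inclusion_exclusion_symmetric[symmetric])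
          (use A in \<open>auto simp: g_def intro: finite_subset\<close>)
      finally show ?thesis .
    qed
    then show "\<exists>l. (\<forall>y. y \<notin> cube n \<longrightarrow> l y = 0) \<and>
        (\<forall>A. A \<subseteq> {1..n} \<longrightarrow> (\<Sum>B\<in>Pow A. l (char_vec B)) = F (char_vec A))"
      by (intro exI[of _ l]) (auto simp: l_def)
  next
    fix l l' :: "(nat \<Rightarrow> bit) \<Rightarrow> real"
    assume l: "(\<forall>y. y \<notin> cube n \<longrightarrow> l y = 0) \<and>
        (\<forall>A. A \<subseteq> {1..n} \<longrightarrow> (\<Sum>B\<in>Pow A. l (char_vec B)) = F (char_vec A))"
      and l': "(\<forall>y. y \<notin> cube n \<longrightarrow> l' y = 0) \<and>
        (\<forall>A. A \<subseteq> {1..n} \<longrightarrow> (\<Sum>B\<in>Pow A. l' (char_vec B)) = F (char_vec A))"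
    \<comment> \<open>For uniqueness, inversion recovers the coefficients from their subset
      sums.\<close>
    have mobius: "f (char_vec A) = (\<Sum>B\<in>Pow A. (- 1) ^ (card A - card B) * (\<Sum>C\<in>Pow B. f (char_vec C)))"
      if "A \<subseteq> {1..n}" for A and f :: "(nat \<Rightarrow> bit) \<Rightarrow> real"
      using that by (intro inclusion_exclusion_mobius) (auto intro: finite_subset)
    have "l (char_vec A) = l' (char_vec A)" if "A \<subseteq> {1..n}" for A
      unfolding mobius[OF that] using that l l' by (intro sum.cong) auto
    then have "l y = l' y" if "y \<in> cube n" for y
      using that unfolding cube_eq_char_vec by blast
    moreover have "l y = l' y" if "y \<notin> cube n" for y
      using that l l' by metis
    ultimately show "l = l'" by blast
  qed
  then have "?P (nnf n F)"
    unfolding nnf_def by (rule theI')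
  then show ?thesis
    using assms by (auto simp: P_iff multilinear_eval_char_vec)
qed

text \<open>The inner product of two indicator vectors is the parity of the size of the
  intersection.\<close>

lemma FH_poly_eval:
  assumes "spanning_trees G \<subseteq> Pow {1..n}" and "A \<subseteq> {1..n}"
  shows "multilinear_eval n (FH_poly n G) (\<lambda>i. of_bool (char_vec A i = 1))
    = (\<Sum>T\<in>spanning_trees G. (- 1) ^ card (T \<inter> A))"
proof -
  have supp: "bool_supp n (tree_fun G) = char_vec ` spanning_trees G"
    using assms(1) by (auto simp: bool_supp_def tree_fun_def cube_eq_char_vec)
  have "(- 1 :: int) ^ of_bool (dot n (char_vec T) (char_vec A) = 1) = (- 1) ^ card (T \<inter> A)"
    if "T \<in> spanning_trees G" for T
  proof -
    have "dot n (char_vec T) (char_vec A) = (\<Sum>i\<in>{1..n}. of_bool (i \<in> T \<inter> A))"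
      unfolding dot_def by (intro sum.cong) (auto simp: char_vec_def)
    also have "\<dots> = of_nat (card ({1..n} \<inter> {i. i \<in> T \<inter> A}))"
      by (rule sum_of_bool_eq[OF finite_atLeastAtMost finite_atLeastAtMost])
    also have "{1..n} \<inter> {i. i \<in> T \<inter> A} = T \<inter> A"
      using that assms by blast
    finally show ?thesis
      by (cases "even (card (T \<inter> A))") (auto elim!: evenE oddE)
  qed
  then have "fourier_hadamard n (tree_fun G) (char_vec A)
      = (\<Sum>T\<in>spanning_trees G. (- 1) ^ card (T \<inter> A))"
    unfolding fourier_hadamard_def supp
    by (subst sum.reindex) (auto intro: inj_on_subset[OF inj_char_vec])
  then show ?thesis
    using nnf_interpolates[OF assms(2)] by (simp add: FH_poly_def)
qed

section \<open>The determinant as a signed count of spanning trees\<close>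

lemma bracket_point_power_diff:
  "bracket_point powi (c - 4 * int m) = bracket_point powi c * (- 1) ^ m"
proof -
  have "bracket_point powi (4 * int m) = (- 1) ^ m"
    by (simp only: power_int_mult bracket_point(5) power_int_of_nat)
  then show ?thesis
    by (simp add: power_int_diff bracket_point(1) divide_inverse flip: power_inverse)
qed

context plane_graph
begin

lemma link_det_medial_diagram:
  assumes "\<forall>e\<in>arcs G. \<chi> e \<in> {1, - 1 :: int}"
  defines "N \<equiv> {e \<in> arcs G. \<chi> e = - 1}"
  shows "link_det (medial_diagram G \<sigma> \<chi>) out
    = \<bar>\<Sum>T\<in>spanning_trees G. (- 1) ^ card (T \<inter> N)\<bar>"
proof -
  let ?D = "medial_diagram G \<sigma> \<chi>"
  \<comment> \<open>On subsets of \<open>arcs G\<close> this is symmetric difference with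
    \<open>N\<close>, hence its own inverse; it exchanges sets of A-smoothed crossings and sets of
    bands.\<close>
  define tw where "tw S = {e \<in> arcs G. e \<in> S \<longleftrightarrow> \<chi> e = 1}" for S
  \<comment> \<open>Obtained by putting
    \<open>card S = card T + card N - 2 * card (T \<inter> N)\<close> and
    \<open>card T = card (verts G) - 1\<close> into \<open>2 * card S - card (arcs G)\<close>, where
    \<open>T = tw S\<close>.\<close>
  define c where "c = 2 * (int (card (verts G)) - 1) + 2 * int (card N) - int (card (arcs G))"
  have cr: "crossings ?D = arcs G" by (simp add: medial_diagram_def)
  have tw: "tw S \<subseteq> arcs G" "S \<subseteq> arcs G \<Longrightarrow> tw (tw S) = S" for S
    by (auto simp: tw_def)
  have loops: "num_loops ?D S = state_loops (tw S)" for S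
    by (simp add: num_loops_medial_diagram tw_def)
  have exponent: "int (card S) - int (card (arcs G - S)) = c - 4 * int (card (tw S \<inter> N))"
    if S: "S \<subseteq> arcs G" and one: "state_loops (tw S) = 1" for S
  proof -
    let ?T = "tw S"
    have fin: "finite S" "finite ?T" "finite N"
      using S tw(1)[of S] finite_arcs by (auto simp: N_def intro: finite_subset)
    have "S = (?T - N) \<union> (N - ?T)"
      using S assms(1) by (auto simp: tw_def N_def)
    then have "card S = card (?T - N) + card (N - ?T)"
      using fin
      by (metis Diff_disjoint Diff_Int_distrib2 Int_Diff Int_empty_right card_Un_disjoint
          finite_Diff inf_commute)
    moreover have "card ?T = card (?T - N) + card (?T \<inter> N)"
      using fin by (metis card_Int_Diff add.commute)
    moreover have "card N = card (N - ?T) + card (?T \<inter> N)"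
      using fin by (metis card_Int_Diff add.commute inf_commute)
    moreover have "card (arcs G) = card S + card (arcs G - S)"
      using S finite_arcs by (metis card_Int_Diff Int_absorb1)
    moreover have "int (card ?T) + 1 = int (card (verts G))"
      using card_one_loop_state[OF tw(1) one] by linarith
    ultimately show ?thesis
      unfolding c_def by (simp add: algebra_simps)
  qed
  have "laurent_eval (kauffman_bracket ?D) bracket_point
      = (\<Sum>S | S \<subseteq> arcs G \<and> num_loops ?D S = 1.
          bracket_point powi (int (card S) - int (card (arcs G - S))))"
    using bracket_eval[of ?D] finite_arcs state_loops_pos by (simp add: cr loops)
  also have "\<dots> = (\<Sum>T\<in>spanning_trees G. bracket_point powi c * (- 1) ^ card (T \<inter> N))"
  proof (rule sum.reindex_bij_witness[of _ tw tw])
    fix S assume "S \<in> {S. S \<subseteq> arcs G \<and> num_loops ?D S = 1}"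
    then have S: "S \<subseteq> arcs G" "state_loops (tw S) = 1" by (simp_all add: loops)
    show "tw (tw S) = S" by (rule tw) fact
    show "tw S \<in> spanning_trees G"
      using S one_loop_state_iff_spanning_tree[OF tw(1)] by blast
    show "bracket_point powi c * (- 1) ^ card (tw S \<inter> N)
        = bracket_point powi (int (card S) - int (card (arcs G - S)))"
      by (simp only: exponent[OF S] bracket_point_power_diff)
  next
    fix T assume "T \<in> spanning_trees G"
    moreover from this have T: "T \<subseteq> arcs G" by (simp add: spanning_trees_def)
    ultimately show "tw (tw T) = T" "tw T \<in> {S. S \<subseteq> arcs G \<and> num_loops ?D S = 1}"
      using one_loop_state_iff_spanning_tree[OF T] tw by (simp_all add: loops)
  qed
  also have "\<dots> = bracket_point powi c * of_real (\<Sum>T\<in>spanning_trees G. (- 1) ^ card (T \<inter> N))"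
    by (simp add: sum_distrib_left)
  finally have "laurent_eval (kauffman_bracket ?D) bracket_point
      = bracket_point powi c * of_real (\<Sum>T\<in>spanning_trees G. (- 1) ^ card (T \<inter> N))" .
  moreover have "link_det ?D out = cmod (laurent_eval (kauffman_bracket ?D) bracket_point)"
    by (rule link_det_eq_bracket) (simp add: cr finite_arcs)
  ultimately show ?thesis
    by (simp only: norm_mult norm_power_int bracket_point(2) norm_of_real) simp
qed

end

theorem theorem1:
  fixes G :: "('v, nat) pre_digraph"
    and \<sigma> :: "nat \<times> bool \<Rightarrow> nat \<times> bool"
    and \<chi> :: "nat \<Rightarrow> int"
    and out :: "nat \<times> compass \<Rightarrow> bool"
    and n :: nat
  assumes "connected_plane_graph G \<sigma>"
    and "arcs G = {1..n}"
    and "\<forall>e \<in> {1..n}. \<chi> e \<in> {1, - 1}"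
    and "orientation (medial_diagram G \<sigma> \<chi>) out"
  shows "link_det (medial_diagram G \<sigma> \<chi>) out
    = \<bar>multilinear_eval n (FH_poly n G) (\<lambda>i. (1 - of_int (\<chi> i)) / 2)\<bar>"
proof -
  interpret plane_graph G \<sigma> by unfold_locales (rule assms(1))
  define N where "N = {e \<in> arcs G. \<chi> e = - 1}"
  have N: "N \<subseteq> {1..n}" unfolding N_def assms(2) by blast
  \<comment> \<open>The point of evaluation is the indicator vector of the negative edges, at least
    on the coordinates that the polynomial reads.\<close>
  have "(1 - of_int (\<chi> i)) / 2 = (of_bool (char_vec N i = 1) :: real)" if "i \<in> {1..n}" for i
    using bspec[OF assms(3) that] that unfolding N_def assms(2) by (auto simp: char_vec_def)
  then have "multilinear_eval n (FH_poly n G) (\<lambda>i. (1 - of_int (\<chi> i)) / 2)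
      = multilinear_eval n (FH_poly n G) (\<lambda>i. of_bool (char_vec N i = 1))"
    unfolding multilinear_eval_def by (intro sum.cong prod.cong arg_cong2[of _ _ _ _ times] refl) simp
  also have "\<dots> = (\<Sum>T\<in>spanning_trees G. (- 1) ^ card (T \<inter> N))"
    by (rule FH_poly_eval[OF _ N]) (unfold spanning_trees_def assms(2), blast)
  finally show ?thesis
    using link_det_medial_diagram[of \<chi> out] assms(2,3) by (simp only: N_def)
qed

end
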